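(* Let $f$ be a finite-order polynomial automorphism of $\mathbb{A}^3_{\mathbb{C}}$ (with coordinates $X,Y,Z$) which fixes the last coordinate $Z$. For each $z\in\mathbb{C}$ let $f_z\in\mathcal{G}$ be the automorphism induced by $f$ on the plane $Z=z$. Then there exist $a,b\in\mathbb{C}^*$ such that for every $z\in\mathbb{C}$ the automorphism $f_z$ is conjugate in $\mathcal{G}$ to the diagonal automorphism $(aX,bY)$.
   Context: $\mathcal{G}$ denotes the group (under composition) of polynomial automorphisms of the affine plane $\mathbb{A}^2_{\mathbb{C}}$; an element is identified with its pair $(f_1,f_2)$ of coordinate functions in $\mathbb{C}[X,Y]$. A polynomial automorphism of $\mathbb{A}^3_{\mathbb{C}}$ fixing the last coordinate is one of the form $(f_1,f_2,Z)$ with $f_1,f_2\in\mathbb{C}[X,Y,Z]$; then $f_z=(f_1(X,Y,z),f_2(X,Y,z))$. *)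

theory Defs
  imports Complex_Main "HOL-Computational_Algebra.Polynomial" "HOL-Algebra.Group"
begin

(* Polynomial rings are iterated, the last variable outermost:
   complex poly poly = C[X][Y] and complex poly poly poly = C[X][Y][Z]. *)

type_synonym poly2 = "complex poly poly"
type_synonym poly3 = "complex poly poly poly"

definition const2 :: "complex \<Rightarrow> poly2" where "const2 c = [:[:c:]:]"
definition X2 :: poly2 where "X2 = [:[:0, 1:]:]"
definition Y2 :: poly2 where "Y2 = [:0, 1:]"

definition const3 :: "complex \<Rightarrow> poly3" where "const3 c = [:[:[:c:]:]:]"
definition X3 :: poly3 where "X3 = [:[:[:0, 1:]:]:]"
definition Y3 :: poly3 where "Y3 = [:[:0, 1:]:]"
definition Z3 :: poly3 where "Z3 = [:0, 1:]"

(* Substitution P(u,v) resp. P(u,v,w), where h embeds the constants into the target ring. *)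

definition eval_hom :: "('a::comm_ring_1 \<Rightarrow> 'r::comm_ring_1) \<Rightarrow> 'r \<Rightarrow> 'a poly \<Rightarrow> 'r" where
  "eval_hom h u P = poly (map_poly h P) u"

definition subst2 :: "poly2 \<Rightarrow> poly2 \<times> poly2 \<Rightarrow> poly2" where
  "subst2 P g = (case g of (u, v) \<Rightarrow> eval_hom (eval_hom const2 u) v P)"

definition subst3 :: "poly3 \<Rightarrow> poly3 \<times> poly3 \<times> poly3 \<Rightarrow> poly3" where
  "subst3 P g = (case g of (u, v, w) \<Rightarrow> eval_hom (eval_hom (eval_hom const3 u) v) w P)"

(* The monoids of polynomial endomorphisms of the affine plane and of affine space;
   the product of f and g is the composition "f after g". *)

definition End_A2 :: "(poly2 \<times> poly2) monoid" where
  "End_A2 = \<lparr>carrier = UNIV,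
     mult = (\<lambda>f g. (subst2 (fst f) g, subst2 (snd f) g)),
     one = (X2, Y2)\<rparr>"

definition End_A3 :: "(poly3 \<times> poly3 \<times> poly3) monoid" where
  "End_A3 = \<lparr>carrier = UNIV,
     mult = (\<lambda>f g. (subst3 (fst f) g, subst3 (fst (snd f)) g, subst3 (snd (snd f)) g)),
     one = (X3, Y3, Z3)\<rparr>"

definition Aut_A2 :: "(poly2 \<times> poly2) monoid" where
  "Aut_A2 = units_of End_A2"

definition Aut_A3 :: "(poly3 \<times> poly3 \<times> poly3) monoid" where
  "Aut_A3 = units_of End_A3"

definition finite_order_in :: "('a, 'm) monoid_scheme \<Rightarrow> 'a \<Rightarrow> bool" where
  "finite_order_in G x \<longleftrightarrow> x \<in> carrier G \<and> (\<exists>n::nat. n > 0 \<and> x [^]\<^bsub>G\<^esub> n = \<one>\<^bsub>G\<^esub>)"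

definition conjugate_in :: "('a, 'm) monoid_scheme \<Rightarrow> 'a \<Rightarrow> 'a \<Rightarrow> bool" where
  "conjugate_in G x y \<longleftrightarrow> x \<in> carrier G \<and> y \<in> carrier G \<and>
     (\<exists>g\<in>carrier G. x = g \<otimes>\<^bsub>G\<^esub> y \<otimes>\<^bsub>G\<^esub> inv\<^bsub>G\<^esub> g)"

definition fixes_last :: "poly3 \<times> poly3 \<times> poly3 \<Rightarrow> bool" where
  "fixes_last f \<longleftrightarrow> snd (snd f) = Z3"

definition at_Z :: "complex \<Rightarrow> poly3 \<Rightarrow> poly2" where
  "at_Z z P = poly P (const2 z)"

definition fibre :: "poly3 \<times> poly3 \<times> poly3 \<Rightarrow> complex \<Rightarrow> poly2 \<times> poly2" where
  "fibre f z = (at_Z z (fst f), at_Z z (fst (snd f)))"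

definition diagonal :: "complex \<Rightarrow> complex \<Rightarrow> poly2 \<times> poly2" where
  "diagonal a b = (const2 a * X2, const2 b * Y2)"


definition ring_hom1 :: "('a::comm_ring_1 \<Rightarrow> 'r::comm_ring_1) \<Rightarrow> bool" where
  "ring_hom1 h \<longleftrightarrow> h 0 = 0 \<and> h 1 = 1 \<and> (\<forall>a b. h (a + b) = h a + h b) \<and> (\<forall>a b. h (a * b) = h a * h b)"

lemma eval_hom_0 [simp]: "eval_hom h u 0 = 0"
  by (simp add: eval_hom_def)

lemma eval_hom_pCons: "h 0 = 0 \<Longrightarrow> eval_hom h u (pCons a p) = h a + u * eval_hom h u p"
  by (simp add: eval_hom_def map_poly_pCons)

lemma ring_hom1_const2: "ring_hom1 const2"
  by (simp add: ring_hom1_def const2_def one_pCons)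

lemma ring_hom1_const3: "ring_hom1 const3"
  by (simp add: ring_hom1_def const3_def one_pCons)

lemma ring_hom1_eval_hom:
  assumes h: "ring_hom1 h"
  shows "ring_hom1 (eval_hom h u)"
proof -
  have h0: "h 0 = 0" and h1: "h 1 = 1" and ha: "\<And>a b. h (a + b) = h a + h b"
    and hm: "\<And>a b. h (a * b) = h a * h b"
    using h by (auto simp: ring_hom1_def)
  have add: "eval_hom h u (p + q) = eval_hom h u p + eval_hom h u q" for p q
    by (induction p q rule: poly_induct2) (simp_all add: eval_hom_pCons h0 ha algebra_simps)
  have sm: "eval_hom h u (smult a p) = h a * eval_hom h u p" for a p
    by (induction p) (simp_all add: eval_hom_pCons h0 hm algebra_simps)
  have mul: "eval_hom h u (p * q) = eval_hom h u p * eval_hom h u q" for p q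
    by (induction p) (simp_all add: eval_hom_pCons h0 add sm algebra_simps)
  show ?thesis
    by (simp add: ring_hom1_def add mul one_pCons eval_hom_pCons h0 h1)
qed

lemma ring_hom1_comp: "ring_hom1 g \<Longrightarrow> ring_hom1 h \<Longrightarrow> ring_hom1 (\<lambda>x. g (h x))"
  by (simp add: ring_hom1_def)

lemma ring_hom1_eq_eval_hom:
  assumes "ring_hom1 k"
  shows "k p = eval_hom (\<lambda>a. k [:a:]) (k [:0, 1:]) p"
proof -
  have k0: "k 0 = 0" using assms by (simp add: ring_hom1_def)
  show ?thesis
  proof (induction p)
    case 0
    show ?case by (simp add: k0)
  next
    case (pCons a p)
    have "k (pCons a p) = k ([:a:] + [:0, 1:] * p)" by simp
    also have "\<dots> = k [:a:] + k [:0, 1:] * k p"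
      using assms unfolding ring_hom1_def by metis
    finally show ?case using pCons by (simp add: eval_hom_pCons k0)
  qed
qed

lemma ring_hom1_subst2: "ring_hom1 (\<lambda>P. subst2 P g)"
  by (cases g) (simp add: subst2_def ring_hom1_eval_hom ring_hom1_const2)

lemma ring_hom1_subst3: "ring_hom1 (\<lambda>P. subst3 P g)"
  by (cases g) (simp add: subst3_def ring_hom1_eval_hom ring_hom1_const3)

lemma ring_hom1_zero: "ring_hom1 h \<Longrightarrow> h 0 = 0"
  by (simp add: ring_hom1_def)

lemma subst2_const2 [simp]: "subst2 (const2 c) g = const2 c"
proof -
  obtain u v where g: "g = (u, v)" by (cases g)
  note z = ring_hom1_zero[OF ring_hom1_const2]
  show ?thesis by (simp add: g subst2_def const2_def[of c] eval_hom_pCons z)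
qed

lemma subst2_X2 [simp]: "subst2 X2 (u, v) = u"
  by (simp add: subst2_def X2_def eval_hom_pCons ring_hom1_zero[OF ring_hom1_const2]
      ring_hom1_const2[unfolded ring_hom1_def])

lemma subst2_Y2 [simp]: "subst2 Y2 (u, v) = v"
  by (simp add: subst2_def Y2_def eval_hom_pCons ring_hom1_zero[OF ring_hom1_const2]
      ring_hom1_eval_hom[OF ring_hom1_const2, unfolded ring_hom1_def])

lemma subst3_const3 [simp]: "subst3 (const3 c) g = const3 c"
proof -
  obtain u v w where g: "g = (u, v, w)" by (cases g)
  note z = ring_hom1_zero[OF ring_hom1_const3]
  show ?thesis by (simp add: g subst3_def const3_def[of c] eval_hom_pCons z)
qed

lemma subst3_X3 [simp]: "subst3 X3 (u, v, w) = u"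
  by (simp add: subst3_def X3_def eval_hom_pCons ring_hom1_zero[OF ring_hom1_const3]
      ring_hom1_const3[unfolded ring_hom1_def])

lemma subst3_Y3 [simp]: "subst3 Y3 (u, v, w) = v"
  by (simp add: subst3_def Y3_def eval_hom_pCons ring_hom1_zero[OF ring_hom1_const3]
      ring_hom1_eval_hom[OF ring_hom1_const3, unfolded ring_hom1_def])

lemma subst3_Z3 [simp]: "subst3 Z3 (u, v, w) = w"
  by (simp add: subst3_def Z3_def eval_hom_pCons ring_hom1_zero[OF ring_hom1_const3]
      ring_hom1_eval_hom[OF ring_hom1_eval_hom[OF ring_hom1_const3], unfolded ring_hom1_def])

lemma ring_hom1_poly2_eqI:
  assumes k: "ring_hom1 k" and l: "ring_hom1 l"
    and "\<And>c. k (const2 c) = l (const2 c)" "k X2 = l X2" "k Y2 = l Y2"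
  shows "k (P :: poly2) = l P"
proof -
  have C: "ring_hom1 (\<lambda>p::complex poly. [:p:])"
    by (simp add: ring_hom1_def one_pCons)
  have "k [:p:] = l [:p:]" for p
    using ring_hom1_eq_eval_hom[OF ring_hom1_comp[OF k C], of p]
      ring_hom1_eq_eval_hom[OF ring_hom1_comp[OF l C], of p] assms(3,4)
    by (simp add: const2_def X2_def)
  then show ?thesis
    using ring_hom1_eq_eval_hom[OF k, of P] ring_hom1_eq_eval_hom[OF l, of P] assms(5)
    by (simp add: Y2_def)
qed

lemma ring_hom1_poly3_eqI:
  assumes k: "ring_hom1 k" and l: "ring_hom1 l"
    and "\<And>c. k (const3 c) = l (const3 c)" "k X3 = l X3" "k Y3 = l Y3" "k Z3 = l Z3"
  shows "k (P :: poly3) = l P"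
proof -
  have C: "ring_hom1 (\<lambda>p::poly2. [:p:])"
    by (simp add: ring_hom1_def one_pCons)
  have "k [:p:] = l [:p:]" for p
    by (rule ring_hom1_poly2_eqI[OF ring_hom1_comp[OF k C] ring_hom1_comp[OF l C]])
      (use assms(3-5) in \<open>simp_all add: const2_def X2_def Y2_def const3_def X3_def Y3_def\<close>)
  then show ?thesis
    using ring_hom1_eq_eval_hom[OF k, of P] ring_hom1_eq_eval_hom[OF l, of P] assms(6)
    by (simp add: Z3_def)
qed

lemma subst2_id [simp]: "subst2 P (X2, Y2) = P"
  by (rule ring_hom1_poly2_eqI[OF ring_hom1_subst2]) (simp_all add: ring_hom1_def)

lemma subst3_id [simp]: "subst3 P (X3, Y3, Z3) = P"
  by (rule ring_hom1_poly3_eqI[OF ring_hom1_subst3]) (simp_all add: ring_hom1_def)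

lemma subst2_subst2: "subst2 (subst2 P (u, v)) g = subst2 P (subst2 u g, subst2 v g)"
  by (rule ring_hom1_poly2_eqI[OF ring_hom1_comp[OF ring_hom1_subst2 ring_hom1_subst2]
        ring_hom1_subst2]) simp_all

lemma subst3_subst3:
  "subst3 (subst3 P (u, v, w)) g = subst3 P (subst3 u g, subst3 v g, subst3 w g)"
  by (rule ring_hom1_poly3_eqI[OF ring_hom1_comp[OF ring_hom1_subst3 ring_hom1_subst3]
        ring_hom1_subst3]) simp_all

lemma monoid_End_A2: "monoid End_A2"
  by unfold_locales (auto simp: End_A2_def subst2_subst2)

lemma monoid_End_A3: "monoid End_A3"
  by unfold_locales (auto simp: End_A3_def subst3_subst3)

lemma group_Aut_A2: "group Aut_A2"
  unfolding Aut_A2_def by (rule monoid.units_group[OF monoid_End_A2])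

lemma group_Aut_A3: "group Aut_A3"
  unfolding Aut_A3_def by (rule monoid.units_group[OF monoid_End_A3])

end

theory Submission
  imports Defs "HOL-Analysis.Analysis" "HOL-Number_Theory.Cong"
begin

text \<open>
  Write f_z for the automorphism induced on the plane Z = z, and n for the order of f.  The proof
  has two halves: each f_z is conjugate to some diagonal automorphism (a_z X, b_z Y), and the
  unordered pair {a_z, b_z} is a locally constant function of z, hence constant since the complex
  line is connected.

  The first half rests on Jung's theorem (\<open>jung\<close>): plane automorphisms are products of affine and
  triangular ones.  It is proved with the lexicographic order in which Y dominates.  For an
  automorphism (f, g) the Jacobian is a nonzero constant, so unless (f, g) is triangular up to
  exchanging its coordinates the leading exponents of f and g are parallel, say p w and s w with
  coprime p and s.  If p = 1 or s = 1, subtracting a multiple of a power of one coordinate from the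
  other lowers the leading term.  The remaining case p, s \<ge> 2 is impossible because X would not be
  a polynomial in f and g (\<open>X2_notin_subalgebra\<close>); this is a weak form of the degree inequality of
  Shestakov and Umirbaev.

  Among all products a_1 b_1 ... a_r b_r of affine a_i and triangular b_i representing a conjugate
  of a given automorphism of finite order, a shortest one has r \<le> 1, and for r = 1 one of its two
  letters lies in both subgroups: otherwise no letter could be absorbed by its neighbours, even
  cyclically, and then the powers of the product would raise the degree of a test curve without
  bound (\<open>ping_pong\<close>).  So the automorphism is conjugate to an affine or a triangular one, an affine
  one is conjugate to a triangular one by means of an eigenvector, and a triangular one is
  conjugate to its diagonal part L by the average of the L^(-i) x^i over i < n.

  For the second half, conjugate f by an automorphism not depending on z so that f_z is exactly
  L = (a X, b Y) at a given z = z_0.  The averages of the L^(-i) f_z^i form a polynomial family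
  phi_z with phi_z f_z = L phi_z that is the identity at z_0.  For z near z_0 the map phi_z is
  close to the identity on a ball; so it has a zero q there, q is a fixed point of f_z, and phi_z
  is invertible to first order at q.  Comparing derivatives at q shows that L and f_z have the
  same eigenvalues (\<open>eigenvalues_locally_constant\<close>).
\<close>

section \<open>Substitution and differentiation in two variables\<close>

abbreviation comp2 :: "poly2 \<times> poly2 \<Rightarrow> poly2 \<times> poly2 \<Rightarrow> poly2 \<times> poly2" (infixl "\<odot>" 70)
  where "f \<odot> g \<equiv> f \<otimes>\<^bsub>End_A2\<^esub> g"

lemma comp2_pair: "(a, b) \<odot> g = (subst2 a g, subst2 b g)"
  by (simp add: End_A2_def)

lemma one_End_A2: "\<one>\<^bsub>End_A2\<^esub> = (X2, Y2)"
  by (simp add: End_A2_def)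

lemma carrier_End_A2 [simp]: "x \<in> carrier End_A2"
  by (simp add: End_A2_def)

lemmas subst2_hom = ring_hom1_subst2[unfolded ring_hom1_def, rule_format]

lemma subst2_0 [simp]: "subst2 0 g = 0"
  and subst2_1 [simp]: "subst2 1 g = 1"
  and subst2_add [simp]: "subst2 (a + b) g = subst2 a g + subst2 b g"
  and subst2_mult [simp]: "subst2 (a * b) g = subst2 a g * subst2 b g"
  using subst2_hom[of g] by blast+

lemma subst2_diff [simp]: "subst2 (a - b) g = subst2 a g - subst2 b g"
  using subst2_add[of "a - b" b g] by simp

lemma subst2_power [simp]: "subst2 (a ^ n) g = subst2 a g ^ n"
  by (induction n) simp_all

lemma subst2_sum [simp]: "subst2 (sum a A) g = (\<Sum>i\<in>A. subst2 (a i) g)"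
  by (induction A rule: infinite_finite_induct) simp_all

lemma const2_0 [simp]: "const2 0 = 0"
  and const2_1 [simp]: "const2 1 = 1"
  by (simp_all add: const2_def one_pCons)

lemma const2_add: "const2 (a + b) = const2 a + const2 b"
  and const2_mult: "const2 (a * b) = const2 a * const2 b"
  and const2_minus: "const2 (- a) = - const2 a"
  by (simp_all add: const2_def)

lemma const2_eq_iff [simp]: "const2 a = const2 b \<longleftrightarrow> a = b"
  by (simp add: const2_def)

lemma const2_eq_0_iff [simp]: "const2 a = 0 \<longleftrightarrow> a = 0"
  by (simp add: const2_def)

lemma poly2_induct [case_names const X Y add mult]:
  assumes c: "\<And>c. P (const2 c)" and X: "P X2" and Y: "P Y2"
    and add: "\<And>p q. P p \<Longrightarrow> P q \<Longrightarrow> P (p + q)"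
    and mult: "\<And>p q. P p \<Longrightarrow> P q \<Longrightarrow> P (p * q)"
  shows "P (p :: poly2)"
proof -
  have base: "P [:a:]" for a
  proof (induction a)
    case 0
    then show ?case using c[of 0] by (simp add: const2_def)
  next
    case (pCons c0 a)
    have "[:pCons c0 a:] = const2 c0 + X2 * [:a:]"
      by (simp add: const2_def X2_def)
    then show ?case using add[OF c[of c0] mult[OF X pCons(2)]] by simp
  qed
  show ?thesis
  proof (induction p)
    case 0
    then show ?case using c[of 0] by (simp add: const2_def)
  next
    case (pCons q p)
    have "pCons q p = [:q:] + Y2 * p" by (simp add: Y2_def)
    then show ?case using add[OF base[of q] mult[OF Y pCons(2)]] by simp
  qed
qed

definition Dx :: "poly2 \<Rightarrow> poly2" where "Dx P = map_poly pderiv P"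

definition Dy :: "poly2 \<Rightarrow> poly2" where "Dy P = pderiv P"

lemma coeff_Dx: "coeff (Dx P) n = pderiv (coeff P n)"
  by (simp add: Dx_def coeff_map_poly)

lemma Dx_add [simp]: "Dx (p + q) = Dx p + Dx q"
  by (rule poly_eqI) (simp add: coeff_Dx pderiv_add)

lemma Dx_mult [simp]: "Dx (p * q) = p * Dx q + q * Dx p"
proof (rule poly_eqI)
  fix n
  have "(\<Sum>i\<le>n. coeff q (n - i) * pderiv (coeff p i)) = (\<Sum>i\<le>n. coeff q i * pderiv (coeff p (n - i)))"
    by (rule sum.reindex_bij_witness[of _ "\<lambda>i. n - i" "\<lambda>i. n - i"]) auto
  then show "coeff (Dx (p * q)) n = coeff (p * Dx q + q * Dx p) n"
    by (simp add: coeff_Dx coeff_mult higher_pderiv_sum[of 1, simplified] pderiv_mult sum.distrib)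
qed

lemma Dy_add [simp]: "Dy (p + q) = Dy p + Dy q"
  by (simp add: Dy_def pderiv_add)

lemma Dy_mult [simp]: "Dy (p * q) = p * Dy q + q * Dy p"
  by (simp add: Dy_def pderiv_mult)

lemma D_const2 [simp]: "Dx (const2 c) = 0" "Dy (const2 c) = 0"
  by (simp_all add: Dx_def Dy_def const2_def map_poly_pCons)

lemma D_X2 [simp]: "Dx X2 = 1" "Dy X2 = 0"
  by (simp_all add: Dx_def Dy_def X2_def map_poly_pCons pderiv_pCons one_pCons)

lemma D_Y2 [simp]: "Dx Y2 = 0" "Dy Y2 = 1"
  by (simp_all add: Dx_def Dy_def Y2_def map_poly_pCons pderiv_pCons one_pCons)

lemma chain_rule:
  shows "Dx (subst2 P (u, v)) = subst2 (Dx P) (u, v) * Dx u + subst2 (Dy P) (u, v) * Dx v"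
    and "Dy (subst2 P (u, v)) = subst2 (Dx P) (u, v) * Dy u + subst2 (Dy P) (u, v) * Dy v"
  by (induction P rule: poly2_induct) (simp_all add: algebra_simps)

definition jac :: "poly2 \<Rightarrow> poly2 \<Rightarrow> poly2" where
  "jac f g = Dx f * Dy g - Dy f * Dx g"

lemma jac_subst2:
  "jac (subst2 P (u, v)) (subst2 Q (u, v)) = subst2 (jac P Q) (u, v) * jac u v"
  by (simp add: jac_def chain_rule algebra_simps)

lemma jac_X2_Y2 [simp]: "jac X2 Y2 = 1"
  by (simp add: jac_def)

lemma Units_End_A2_iff:
  "f \<in> Units End_A2 \<longleftrightarrow> (\<exists>g. f \<odot> g = (X2, Y2) \<and> g \<odot> f = (X2, Y2))"
  by (auto simp: Units_def one_End_A2)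

lemma Units_obtain:
  assumes "(f, g) \<in> Units End_A2"
  obtains h k where "subst2 f (h, k) = X2" "subst2 g (h, k) = Y2"
    "subst2 h (f, g) = X2" "subst2 k (f, g) = Y2"
proof -
  obtain p where "(f, g) \<odot> p = (X2, Y2)" "p \<odot> (f, g) = (X2, Y2)"
    using assms by (auto simp: Units_End_A2_iff)
  then show ?thesis
    by (cases p) (auto simp: comp2_pair intro: that)
qed

lemma jac_Units_dvd:
  assumes "(f, g) \<in> Units End_A2"
  shows "jac f g dvd 1"
proof -
  obtain h k where "subst2 h (f, g) = X2" "subst2 k (f, g) = Y2"
    using Units_obtain[OF assms] by blast
  then have "1 = subst2 (jac h k) (f, g) * jac f g"
    using jac_subst2[of h f g k] by simp
  then show ?thesis by (metis dvd_triv_right)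
qed

lemma jac_Units:
  assumes "(f, g) \<in> Units End_A2"
  obtains c where "c \<noteq> 0" "jac f g = const2 c"
proof -
  have 1: "jac f g dvd 1" by (rule jac_Units_dvd[OF assms])
  then obtain p where p: "jac f g = [:p:]" "p dvd 1" by (auto simp: is_unit_poly_iff)
  then obtain c where "p = [:c:]" "c dvd 1"  by (auto simp: is_unit_poly_iff)
  then show ?thesis using p by (intro that[of c]) (auto simp: const2_def)
qed

section \<open>Multiplicities of roots of sparse polynomials\<close>

lemma poly_higher_pderiv_order:
  fixes T :: "complex poly"
  assumes "T \<noteq> 0"
  shows "poly ((pderiv ^^ Polynomial.order c T) T) c \<noteq> 0"
  using assms
proof (induction "Polynomial.order c T" arbitrary: T)
  case 0
  then show ?case by (metis funpow_0 order_root)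
next
  case (Suc n)
  have 0: "poly T c = 0" using Suc.hyps(2) by (metis order_0I nat.distinct(1))
  then have e: "Polynomial.order c T = Suc (Polynomial.order c (pderiv T))"
    using Suc.prems by (intro order_pderiv)
  have "pderiv T \<noteq> 0"
    using 0 Suc.prems pderiv_iszero by fastforce
  then show ?case
    using Suc.hyps(1)[of "pderiv T"] e Suc.hyps(2) by (simp add: funpow_swap1)
qed

lemma coeff_pcompose_monom:
  assumes "p > 0"
  shows "coeff (pcompose (U :: 'a :: comm_ring_1 poly) (monom 1 p)) n = (if p dvd n then coeff U (n div p) else 0)"
proof (induction U arbitrary: n)
  case 0
  then show ?case by simp
next
  case (pCons a U)
  show ?case
  proof (cases "n < p")
    case True
    then show ?thesis using assms
      by (cases "n = 0") (auto simp: pcompose_pCons coeff_monom_mult coeff_pCons split: nat.split dest: dvd_imp_le)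
  next
    case False
    then have "p dvd n \<longleftrightarrow> p dvd (n - p)" "n div p = Suc ((n - p) div p)"
      using assms by (auto simp: dvd_minus_self le_div_geq)
    then show ?thesis using False assms pCons.IH[of "n - p"]
      by (auto simp: pcompose_pCons coeff_monom_mult coeff_pCons split: nat.split)
  qed
qed

lemma order_root_power:
  assumes "p > 0" "(c::complex) \<noteq> 0"
  shows "Polynomial.order c (monom 1 p - [:c ^ p:]) = 1"
proof -
  let ?q = "monom 1 p - [:c ^ p:]"
  have d: "pderiv ?q = monom (of_nat p) (p - 1)"
    by (simp add: pderiv_diff pderiv_monom)
  have nz: "pderiv ?q \<noteq> 0" using assms d by simp
  have "?q \<noteq> 0" using nz by fastforce
  moreover have "poly ?q c = 0" by (simp add: poly_monom)
  ultimately have "Polynomial.order c ?q = Suc (Polynomial.order c (pderiv ?q))"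
    by (rule order_pderiv)
  moreover have "Polynomial.order c (pderiv ?q) = 0"
    using assms by (intro order_0I) (simp add: d poly_monom)
  ultimately show ?thesis by simp
qed

text \<open>The map Y \<mapsto> Y^p is unramified away from 0, so it preserves multiplicities of nonzero roots.\<close>

lemma order_pcompose_monom:
  assumes "p > 0" "(c::complex) \<noteq> 0" "U \<noteq> 0"
  shows "Polynomial.order c (pcompose U (monom 1 p)) = Polynomial.order (c ^ p) U"
proof -
  \<comment> \<open>split off the full power of the linear factor at c^p\<close>
  obtain V where V: "U = [:- (c ^ p), 1:] ^ Polynomial.order (c ^ p) U * V" "\<not> [:- (c ^ p), 1:] dvd V"
    using order_decomp[OF assms(3)] by blast
  let ?k = "Polynomial.order (c ^ p) U"
  have "poly V (c ^ p) \<noteq> 0" using V(2) by (simp add: poly_eq_0_iff_dvd)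
  then have 0: "Polynomial.order c (pcompose V (monom 1 p)) = 0"
    by (intro order_0I) (simp add: poly_pcompose poly_monom)
  have lin: "pcompose [:- (c ^ p), 1:] (monom 1 p) = monom 1 p - [:c ^ p:]"
    by (simp add: pcompose_pCons)
  have nz: "pcompose U (monom 1 p) \<noteq> 0"
    using assms by (simp add: pcompose_eq_0_iff degree_monom_eq)
  have pw: "pcompose (q ^ k) r = pcompose q r ^ k" for q r :: "complex poly" and k
    by (induction k) (simp_all add: pcompose_1 pcompose_mult)
  have eq: "pcompose U (monom 1 p) = (monom 1 p - [:c ^ p:]) ^ ?k * pcompose V (monom 1 p)"
    by (subst V(1)) (simp only: pcompose_mult pw lin)
  have ordpow: "Polynomial.order c (q ^ k) = k * Polynomial.order c q" if "q \<noteq> 0" for q :: "complex poly" and k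
    using that by (induction k) (simp_all add: order_mult)
  have nz': "monom 1 p - [:c ^ p:] \<noteq> 0"
  proof -
    have "coeff (monom 1 p - [:c ^ p:]) p = 1"
      using assms(1) by (simp add: coeff_pCons split: nat.split)
    then show ?thesis by (metis coeff_0 zero_neq_one)
  qed
  have "Polynomial.order c (pcompose U (monom 1 p)) = Polynomial.order c ((monom 1 p - [:c ^ p:]) ^ ?k)"
    using nz 0 unfolding eq by (simp add: order_mult)
  also have "\<dots> = ?k" using order_root_power[OF assms(1,2)] nz' by (simp add: ordpow)
  finally show ?thesis .
qed

text \<open>If all exponents of T are congruent modulo p, then T is a monomial times a polynomial in Y^p.
  A nonzero root of multiplicity i thus comes with its p rotations by roots of unity, all of
  multiplicity i.\<close>

lemma order_sparse_poly:
  fixes T :: "complex poly"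
  assumes p: "p > 0" and c: "c \<noteq> 0" and T: "T \<noteq> 0"
    and sparse: "\<And>i j. coeff T i \<noteq> 0 \<Longrightarrow> coeff T j \<noteq> 0 \<Longrightarrow> i mod p = j mod p"
  shows "p * Polynomial.order c T \<le> degree T"
proof -
  define b where "b = degree T mod p"
  define U where "U = Poly (map (\<lambda>j. coeff T (b + p * j)) [0..<Suc (degree T)])"
  have cU: "coeff U j = coeff T (b + p * j)" for j
  proof (cases "j < Suc (degree T)")
    case False
    have "1 * j \<le> p * j" using p by (intro mult_le_mono1) simp
    then have "b + p * j > degree T" using False by linarith
    then show ?thesis using False by (simp add: U_def nth_default_def coeff_eq_0)
  qed (simp add: U_def nth_default_def del: upt_Suc)
  have eq: "T = monom 1 b * pcompose U (monom 1 p)"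
  proof (rule poly_eqI)
    fix n
    have lead: "coeff T (degree T) \<noteq> 0" using T by simp
    show "coeff T n = coeff (monom 1 b * pcompose U (monom 1 p)) n"
    proof (cases "coeff T n = 0")
      case True
      then show ?thesis using p
        by (auto simp: coeff_monom_mult coeff_pcompose_monom cU)
    next
      case False
      then have "n mod p = b" using sparse[OF False lead] by (simp add: b_def)
      then have "b \<le> n" "p dvd (n - b)" "b + (n - b) = n"
        by (auto simp: mod_less_eq_dividend dvd_minus_mod)
      then show ?thesis using p by (simp add: coeff_monom_mult coeff_pcompose_monom cU)
    qed
  qed
  have U: "U \<noteq> 0" using T eq by auto
  have nz: "monom 1 b * pcompose U (monom 1 p) \<noteq> 0" using T eq by metis
  have "Polynomial.order c T = Polynomial.order c (pcompose U (monom 1 p))"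
    using c order_mult[OF nz, of c] unfolding eq[symmetric]
    by (simp add: order_0I poly_monom)
  also have "\<dots> \<le> degree U" using order_pcompose_monom[OF p c U] U by (simp add: order_degree)
  finally have "p * Polynomial.order c T \<le> degree (pcompose U (monom 1 p))"
    by (simp add: degree_pcompose degree_monom_eq)
  also have "\<dots> \<le> degree T"
    using nz by (subst eq) (simp add: degree_mult_eq)
  finally show ?thesis .
qed

section \<open>Lexicographic leading terms\<close>

text \<open>The pair (j, i) stands for the monomial Y^j X^i, and pairs are ordered lexicographically.\<close>

definition lex_coeff :: "poly2 \<Rightarrow> nat \<Rightarrow> nat \<Rightarrow> complex" where
  "lex_coeff P j i = coeff (coeff P j) i"

text \<open>The leading monomial is at most (j, i).  Working with an upper bound together with the
  coefficient at the bound, rather than with the leading monomial itself, makes both additive under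
  sums and multiplicative under products without any case distinction on cancellation.\<close>

definition lex_le :: "poly2 \<Rightarrow> nat \<Rightarrow> nat \<Rightarrow> bool" where
  "lex_le P j i \<longleftrightarrow> degree P \<le> j \<and> degree (coeff P j) \<le> i"

lemma coeff_mult_top:
  assumes "degree (p :: 'a :: comm_ring_1 poly) \<le> m" "degree q \<le> n"
  shows "coeff (p * q) (m + n) = coeff p m * coeff q n"
proof (cases "degree p = m \<and> degree q = n")
  case True
  then show ?thesis using coeff_mult_degree_sum[of p q] by simp
next
  case False
  then have "degree (p * q) < m + n" "coeff p m = 0 \<or> coeff q n = 0"
    using assms degree_mult_le[of p q] by (auto simp: coeff_eq_0)
  then show ?thesis by (auto simp: coeff_eq_0)
qed

lemma lex_le_mult:
  assumes "lex_le P j i" "lex_le Q k l"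
  shows "lex_le (P * Q) (j + k) (i + l)" "lex_coeff (P * Q) (j + k) (i + l) = lex_coeff P j i * lex_coeff Q k l"
proof -
  have c: "coeff (P * Q) (j + k) = coeff P j * coeff Q k"
    using assms by (intro coeff_mult_top) (auto simp: lex_le_def)
  show "lex_le (P * Q) (j + k) (i + l)"
    using assms degree_mult_le[of P Q] degree_mult_le[of "coeff P j" "coeff Q k"]
    by (simp add: lex_le_def c)
  show "lex_coeff (P * Q) (j + k) (i + l) = lex_coeff P j i * lex_coeff Q k l"
    using assms by (simp add: lex_coeff_def c coeff_mult_top lex_le_def)
qed

lemma lex_le_const2: "lex_le (const2 c) 0 0" "lex_coeff (const2 c) 0 0 = c"
  by (simp_all add: lex_le_def lex_coeff_def const2_def)

lemma lex_le_power:
  assumes "lex_le P j i"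
  shows "lex_le (P ^ k) (k * j) (k * i)" "lex_coeff (P ^ k) (k * j) (k * i) = lex_coeff P j i ^ k"
proof (induction k)
  case 0
  { case 1 show ?case using lex_le_const2(1)[of 1] by simp
  next case 2 show ?case using lex_le_const2(2)[of 1] by simp }
next
  case (Suc k)
  { case 1 show ?case using lex_le_mult(1)[OF assms Suc(1)] by simp
  next case 2 show ?case using lex_le_mult(2)[OF assms Suc(1)] Suc(2) by simp }
qed

lemma lex_le_0: "lex_le 0 j i" "lex_coeff 0 j i = 0"
  by (simp_all add: lex_le_def lex_coeff_def)

lemma lex_le_add:
  "lex_le P j i \<Longrightarrow> lex_le Q j i \<Longrightarrow> lex_le (P + Q) j i"
  "lex_coeff (P + Q) j i = lex_coeff P j i + lex_coeff Q j i"
  by (auto simp: lex_le_def lex_coeff_def intro!: degree_add_le)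

lemma lex_le_sum:
  "(\<And>x. x \<in> A \<Longrightarrow> lex_le (F x) j i) \<Longrightarrow> lex_le (sum F A) j i"
  "lex_coeff (sum F A) j i = (\<Sum>x\<in>A. lex_coeff (F x) j i)"
  by (induction A rule: infinite_finite_induct) (auto simp: lex_le_0 lex_le_add)

lemma lex_le_weaken:
  assumes "lex_le P j i" "j < k \<or> j = k \<and> i < l"
  shows "lex_le P k l" "lex_coeff P k l = 0"
  using assms by (auto simp: lex_le_def lex_coeff_def coeff_eq_0)

lemma lex_le_lead:
  assumes "P \<noteq> 0"
  shows "lex_le P (degree P) (degree (lead_coeff P))" "lex_coeff P (degree P) (degree (lead_coeff P)) \<noteq> 0"
  using assms by (auto simp: lex_le_def lex_coeff_def)

lemma lex_le_degree: "lex_le P j i \<Longrightarrow> lex_coeff P j i \<noteq> 0 \<Longrightarrow> degree P = j"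
  by (auto simp: lex_le_def lex_coeff_def intro!: antisym le_degree)

lemma lex_le_cancel:
  assumes "lex_le P j i" "lex_coeff P j i = 0" "P \<noteq> 0"
  shows "degree P < j \<or> degree P = j \<and> degree (lead_coeff P) < i"
  using assms unfolding lex_le_def lex_coeff_def by (metis le_neq_implies_less leading_coeff_0_iff)

lemma monom2: "const2 c * X2 ^ a * Y2 ^ b = monom (monom c a) b"
proof -
  have X: "X2 ^ a = [:monom 1 a:]"
    by (induction a) (simp_all add: X2_def one_pCons monom_Suc monom_0)
  have Y: "Y2 ^ b = monom 1 b"
    by (simp add: Y2_def monom_altdef)
  show ?thesis by (simp add: X Y const2_def smult_monom)
qed

lemma poly2_expand:
  assumes "\<And>j i. lex_coeff G j i \<noteq> 0 \<Longrightarrow> j \<le> N \<and> i \<le> N"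
  shows "G = (\<Sum>j\<le>N. \<Sum>i\<le>N. const2 (lex_coeff G j i) * X2 ^ i * Y2 ^ j)"
proof (rule poly_eqI, rule poly_eqI)
  fix j i
  have *: "lex_coeff G j i = (if j \<le> N \<and> i \<le> N then lex_coeff G j i else 0)"
    using assms[of j i] by auto
  have "coeff (coeff (\<Sum>j\<le>N. \<Sum>i\<le>N. const2 (lex_coeff G j i) * X2 ^ i * Y2 ^ j) j) i
    = (\<Sum>j'\<le>N. \<Sum>i'\<le>N. if j' = j then (if i' = i then lex_coeff G j' i' else 0) else 0)"
    unfolding monom2 coeff_sum
    by (intro sum.cong refl) (auto simp: )
  also have "\<dots> = (\<Sum>j'\<le>N. if j' = j then (\<Sum>i'\<le>N. if i' = i then lex_coeff G j' i' else 0) else 0)"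
    by (intro sum.cong refl) auto
  also have "\<dots> = (if j \<le> N \<and> i \<le> N then lex_coeff G j i else 0)"
    by (simp add: sum.delta)
  finally show "coeff (coeff G j) i = coeff (coeff (\<Sum>j\<le>N. \<Sum>i\<le>N. const2 (lex_coeff G j i) * X2 ^ i * Y2 ^ j) j) i"
    using * by (simp add: lex_coeff_def)
qed

text \<open>The operators X d/dX and Y d/dY multiply each monomial by a scalar, whereas the plain
  derivatives shift exponents and would need truncated subtraction.  The Jacobian is expressed through them below, at
  the price of a factor X Y.\<close>

lemma euler_x: assumes "lex_le P j i"
  shows "lex_le (X2 * Dx P) j i" "lex_coeff (X2 * Dx P) j i = of_nat i * lex_coeff P j i"
proof -
  have e: "coeff (X2 * Dx P) j = [:0, 1:] * pderiv (coeff P j)" for j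
    by (simp add: X2_def coeff_Dx)
  have d: "degree (X2 * Dx P) \<le> degree P"
    by (rule degree_le) (simp add: e coeff_eq_0)
  have "degree ([:0, 1:] * pderiv (coeff P j)) \<le> degree (coeff P j)"
  proof (cases "degree (coeff P j) = 0")
    case True
    then have "pderiv (coeff P j) = 0" by (simp add: pderiv_eq_0_iff)
    then show ?thesis by simp
  next
    case False
    then show ?thesis
      using degree_pCons_le[of 0 "pderiv (coeff P j)"] by (simp add: degree_pderiv)
  qed
  then show "lex_le (X2 * Dx P) j i"
    using assms d by (auto simp: lex_le_def e)
  show "lex_coeff (X2 * Dx P) j i = of_nat i * lex_coeff P j i"
    by (cases i) (auto simp: lex_coeff_def e coeff_pderiv coeff_pCons)
qed

lemma coeff_of_nat_mult_poly: "coeff (of_nat n * (q :: complex poly)) i = of_nat n * coeff q i"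
  by (simp add: of_nat_poly)

lemma euler_y: assumes "lex_le P j i"
  shows "lex_le (Y2 * Dy P) j i" "lex_coeff (Y2 * Dy P) j i = of_nat j * lex_coeff P j i"
proof -
  have e: "coeff (Y2 * Dy P) j = of_nat j * coeff P j" for j
    by (cases j) (auto simp: Y2_def Dy_def coeff_pderiv coeff_pCons)
  have d: "degree (Y2 * Dy P) \<le> degree P"
    by (rule degree_le) (simp add: e coeff_eq_0)
  have "degree (of_nat j * coeff P j) \<le> degree (coeff P j)"
    by (rule degree_le) (simp add: coeff_of_nat_mult_poly coeff_eq_0)
  then show "lex_le (Y2 * Dy P) j i"
    using assms d by (auto simp: lex_le_def e)
  show "lex_coeff (Y2 * Dy P) j i = of_nat j * lex_coeff P j i"
    by (simp add: lex_coeff_def e coeff_of_nat_mult_poly)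
qed

text \<open>The scalar is the determinant of the two exponent vectors: if the leading monomials are
  not parallel, they determine the leading monomial of the Jacobian.\<close>

lemma lead_jac:
  assumes f: "lex_le f n a" and g: "lex_le g m b"
  shows "lex_coeff (X2 * Y2 * jac f g) (n + m) (a + b) = (of_nat a * of_nat m - of_nat n * of_nat b) * lex_coeff f n a * lex_coeff g m b"
proof -
  have "X2 * Y2 * jac f g + (Y2 * Dy f) * (X2 * Dx g) = (X2 * Dx f) * (Y2 * Dy g)"
    by (simp add: jac_def algebra_simps)
  then have "lex_coeff (X2 * Y2 * jac f g) (n + m) (a + b) + lex_coeff ((Y2 * Dy f) * (X2 * Dx g)) (n + m) (a + b)
     = lex_coeff ((X2 * Dx f) * (Y2 * Dy g)) (n + m) (a + b)"
    by (metis lex_le_add(2))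
  then show ?thesis
    unfolding lex_le_mult(2)[OF euler_x(1)[OF f] euler_y(1)[OF g]]
      lex_le_mult(2)[OF euler_y(1)[OF f] euler_x(1)[OF g]] euler_x(2)[OF f] euler_x(2)[OF g]
      euler_y(2)[OF f] euler_y(2)[OF g]
    by (simp add: algebra_simps)
qed

section \<open>Weighted leading parts\<close>

text \<open>Give X and Y the weights p and s.  This is the part of G of weight W, with X specialised to
  the number \<open>\<phi>\<close>: a polynomial in Y alone.  When W is the weighted degree of G, and f and g have
  leading terms in the ratio p : s, its value at the leading coefficient of g decides whether the
  leading terms cancel in G(f, g).\<close>

definition weighted_top :: "nat \<Rightarrow> nat \<Rightarrow> nat \<Rightarrow> complex \<Rightarrow> poly2 \<Rightarrow> complex poly" where
  "weighted_top p s W \<phi> G = (\<Sum>\<beta>\<le>W. monom (if s * \<beta> \<le> W \<and> p dvd (W - s * \<beta>)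
      then lex_coeff G \<beta> ((W - s * \<beta>) div p) * \<phi> ^ ((W - s * \<beta>) div p) else 0) \<beta>)"

lemma coeff_weighted_top:
  assumes "s > 0"
  shows "coeff (weighted_top p s W \<phi> G) \<beta> = (if s * \<beta> \<le> W \<and> p dvd (W - s * \<beta>)
      then lex_coeff G \<beta> ((W - s * \<beta>) div p) * \<phi> ^ ((W - s * \<beta>) div p) else 0)"
proof -
  have "\<beta> \<le> s * \<beta>" using assms by simp
  then have "s * \<beta> \<le> W \<Longrightarrow> \<beta> \<le> W" by linarith
  then show ?thesis by (auto simp: weighted_top_def coeff_sum sum.delta)
qed

definition weight_le :: "nat \<Rightarrow> nat \<Rightarrow> nat \<Rightarrow> poly2 \<Rightarrow> bool" where
  "weight_le p s W G \<longleftrightarrow> (\<forall>\<alpha> \<beta>. lex_coeff G \<beta> \<alpha> \<noteq> 0 \<longrightarrow> p * \<alpha> + s * \<beta> \<le> W)"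

lemma lex_coeff_Dy: "lex_coeff (Dy G) \<beta> \<alpha> = of_nat (Suc \<beta>) * lex_coeff G (Suc \<beta>) \<alpha>"
  unfolding lex_coeff_def Dy_def coeff_pderiv by (rule coeff_of_nat_mult_poly)

lemma weighted_top_Dy:
  assumes "weight_le p s W G" "s \<le> W" "s > 0"
  shows "weight_le p s (W - s) (Dy G)" "weighted_top p s (W - s) \<phi> (Dy G) = pderiv (weighted_top p s W \<phi> G)"
proof -
  show "weight_le p s (W - s) (Dy G)"
    unfolding weight_le_def
  proof (intro allI impI)
    fix \<alpha> \<beta> assume "lex_coeff (Dy G) \<beta> \<alpha> \<noteq> 0"
    then have "lex_coeff G (Suc \<beta>) \<alpha> \<noteq> 0" by (auto simp: lex_coeff_Dy)
    then have "p * \<alpha> + s * Suc \<beta> \<le> W" using assms(1) unfolding weight_le_def by blast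
    then show "p * \<alpha> + s * \<beta> \<le> W - s" by simp
  qed
  show "weighted_top p s (W - s) \<phi> (Dy G) = pderiv (weighted_top p s W \<phi> G)"
  proof (rule poly_eqI)
    fix \<beta>
    have "s * \<beta> \<le> W - s \<longleftrightarrow> s * Suc \<beta> \<le> W" "W - s - s * \<beta> = W - s * Suc \<beta>"
      using assms(2) by auto
    then show "coeff (weighted_top p s (W - s) \<phi> (Dy G)) \<beta> = coeff (pderiv (weighted_top p s W \<phi> G)) \<beta>"
      by (simp add: coeff_weighted_top[OF assms(3)] coeff_pderiv lex_coeff_Dy del: mult_Suc_right)
  qed
qed

lemma weighted_top_Dy_iter:
  assumes "weight_le p s W G" "i * s \<le> W" "s > 0"
  shows "weight_le p s (W - i * s) ((Dy ^^ i) G) \<and>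
    weighted_top p s (W - i * s) \<phi> ((Dy ^^ i) G) = (pderiv ^^ i) (weighted_top p s W \<phi> G)"
  using assms(2)
proof (induction i)
  case 0
  then show ?case using assms by simp
next
  case (Suc i)
  have 1: "weight_le p s (W - i * s) ((Dy ^^ i) G)"
    "weighted_top p s (W - i * s) \<phi> ((Dy ^^ i) G) = (pderiv ^^ i) (weighted_top p s W \<phi> G)"
    using Suc by auto
  have "s \<le> W - i * s" "W - i * s - s = W - Suc i * s" using Suc.prems by auto
  then show ?case using weighted_top_Dy(1)[OF 1(1) _ assms(3)] weighted_top_Dy(2)[OF 1(1) _ assms(3), of \<phi>] 1(2) by simp
qed

text \<open>All monomials of weight less than W contribute terms below (W u, W v), since u is positive;
  those of weight W contribute the terms of the specialised leading part.\<close>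

lemma lead_subst2:
  assumes f: "lex_le f (p * u) (p * v)" and g: "lex_le g (s * u) (s * v)"
    and u: "u > 0" and ps: "p > 0" "s > 0" and G: "weight_le p s W G"
  shows "lex_le (subst2 G (f, g)) (W * u) (W * v)"
    "lex_coeff (subst2 G (f, g)) (W * u) (W * v) = poly (weighted_top p s W (lex_coeff f (p * u) (p * v)) G) (lex_coeff g (s * u) (s * v))"
proof -
  define \<phi> \<gamma> where "\<phi> = lex_coeff f (p * u) (p * v)" and "\<gamma> = lex_coeff g (s * u) (s * v)"
  have bnd: "lex_coeff G \<beta> \<alpha> \<noteq> 0 \<Longrightarrow> \<beta> \<le> W \<and> \<alpha> \<le> W" for \<alpha> \<beta>
  proof -
    assume "lex_coeff G \<beta> \<alpha> \<noteq> 0"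
    then have "p * \<alpha> + s * \<beta> \<le> W" using G by (auto simp: weight_le_def)
    moreover have "\<alpha> \<le> p * \<alpha>" "\<beta> \<le> s * \<beta>" using ps by auto
    ultimately show ?thesis by linarith
  qed
  define t where "t \<beta> \<alpha> = const2 (lex_coeff G \<beta> \<alpha>) * f ^ \<alpha> * g ^ \<beta>" for \<beta> \<alpha>
  have S: "subst2 G (f, g) = (\<Sum>\<beta>\<le>W. \<Sum>\<alpha>\<le>W. t \<beta> \<alpha>)"
    by (subst poly2_expand[of G W, OF bnd]) (simp_all add: t_def)
  have t: "lex_le (t \<beta> \<alpha>) (W * u) (W * v) \<and> lex_coeff (t \<beta> \<alpha>) (W * u) (W * v) =
      (if p * \<alpha> + s * \<beta> = W then lex_coeff G \<beta> \<alpha> * \<phi> ^ \<alpha> * \<gamma> ^ \<beta> else 0)" for \<alpha> \<beta>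
  proof (cases "lex_coeff G \<beta> \<alpha> = 0")
    case True
    then show ?thesis by (simp add: t_def lex_le_0)
  next
    case False
    let ?w = "p * \<alpha> + s * \<beta>"
    have le: "?w \<le> W" using False G by (auto simp: weight_le_def)
    note m = lex_le_mult[OF lex_le_mult(1)[OF lex_le_const2(1)[of "lex_coeff G \<beta> \<alpha>"] lex_le_power(1)[OF f, of \<alpha>]]
        lex_le_power(1)[OF g, of \<beta>]]
    have eq: "0 + \<alpha> * (p * u) + \<beta> * (s * u) = ?w * u" "0 + \<alpha> * (p * v) + \<beta> * (s * v) = ?w * v"
      by (simp_all add: algebra_simps)
    have l: "lex_le (t \<beta> \<alpha>) (?w * u) (?w * v)" and c: "lex_coeff (t \<beta> \<alpha>) (?w * u) (?w * v) = lex_coeff G \<beta> \<alpha> * \<phi> ^ \<alpha> * \<gamma> ^ \<beta>"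
      using m unfolding eq lex_le_mult(2)[OF lex_le_const2(1)[of "lex_coeff G \<beta> \<alpha>"] lex_le_power(1)[OF f, of \<alpha>]]
        lex_le_const2(2) lex_le_power(2)[OF f] lex_le_power(2)[OF g] by (simp_all add: t_def \<phi>_def \<gamma>_def)
    show ?thesis
    proof (cases "?w = W")
      case True
      then show ?thesis using l c by simp
    next
      case False
      then have "?w * u < W * u" using le u by simp
      then show ?thesis using lex_le_weaken[OF l, of "W * u" "W * v"] False by simp
    qed
  qed
  show "lex_le (subst2 G (f, g)) (W * u) (W * v)"
    unfolding S by (intro lex_le_sum) (simp add: t)
  have "lex_coeff (subst2 G (f, g)) (W * u) (W * v) =
      (\<Sum>\<beta>\<le>W. \<Sum>\<alpha>\<le>W. if p * \<alpha> + s * \<beta> = W then lex_coeff G \<beta> \<alpha> * \<phi> ^ \<alpha> * \<gamma> ^ \<beta> else 0)"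
    unfolding S lex_le_sum(2) by (simp add: t)
  also have "\<dots> = (\<Sum>\<beta>\<le>W. coeff (weighted_top p s W \<phi> G) \<beta> * \<gamma> ^ \<beta>)"
  proof (intro sum.cong refl)
    fix \<beta> assume "\<beta> \<in> {..W}"
    show "(\<Sum>\<alpha>\<le>W. if p * \<alpha> + s * \<beta> = W then lex_coeff G \<beta> \<alpha> * \<phi> ^ \<alpha> * \<gamma> ^ \<beta> else 0)
      = coeff (weighted_top p s W \<phi> G) \<beta> * \<gamma> ^ \<beta>"
    proof (cases "s * \<beta> \<le> W \<and> p dvd (W - s * \<beta>)")
      case True
      define \<alpha>0 where "\<alpha>0 = (W - s * \<beta>) div p"
      have "p * \<alpha> + s * \<beta> = W \<longleftrightarrow> \<alpha> = \<alpha>0" for \<alpha>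
        using True ps by (auto simp: \<alpha>0_def)
      moreover have "\<alpha>0 \<le> W" using True by (auto simp: \<alpha>0_def intro: order.trans[OF div_le_dividend])
      ultimately show ?thesis using True by (simp add: coeff_weighted_top[OF ps(2)] sum.delta \<alpha>0_def[symmetric])
    next
      case False
      then have "p * \<alpha> + s * \<beta> \<noteq> W" for \<alpha> by auto
      then show ?thesis using False by (auto simp: coeff_weighted_top[OF ps(2)])
    qed
  qed
  also have "\<dots> = poly (weighted_top p s W \<phi> G) \<gamma>"
  proof -
    have "degree (weighted_top p s W \<phi> G) \<le> W"
      unfolding weighted_top_def by (intro degree_sum_le) (auto intro: order.trans[OF degree_monom_le])
    from arg_cong[OF poly_as_sum_of_monoms'[OF this], of "\<lambda>q. poly q \<gamma>"]
    show ?thesis by (simp add: poly_sum poly_monom)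
  qed
  finally show "lex_coeff (subst2 G (f, g)) (W * u) (W * v) = poly (weighted_top p s W (lex_coeff f (p * u) (p * v)) G) (lex_coeff g (s * u) (s * v))"
    by (simp add: \<phi>_def \<gamma>_def)
qed

section \<open>A degree bound for polynomials in two algebraically independent ones\<close>

text \<open>The derivation \<open>jac f\<close> kills f, so on polynomials in f and g it acts as the derivative with
  respect to the second argument, up to the factor \<open>jac f g\<close>.\<close>

lemma jac_chain: "jac f (subst2 G (f, g)) = subst2 (Dy G) (f, g) * jac f g"
  using jac_subst2[of X2 f g G] by (simp add: jac_def)

lemma degree_Dx_le: "degree (Dx f) \<le> degree f"
  by (rule degree_le) (simp add: coeff_Dx coeff_eq_0)

lemma degree_jac_le:
  assumes "degree f > 0"
  shows "degree (jac f P) \<le> degree f + degree P - 1"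
proof -
  have "degree (Dx f * Dy P) \<le> degree f + degree P - 1"
  proof (cases "degree P = 0")
    case True
    then have "Dy P = 0" by (simp add: Dy_def pderiv_eq_0_iff)
    then show ?thesis by simp
  next
    case False
    then show ?thesis
      using degree_mult_le[of "Dx f" "Dy P"] degree_Dx_le[of f] by (simp add: Dy_def degree_pderiv)
  qed
  moreover have "degree (Dy f * Dx P) \<le> degree f + degree P - 1"
    using degree_mult_le[of "Dy f" "Dx P"] degree_Dx_le[of P] assms by (simp add: Dy_def degree_pderiv)
  ultimately show ?thesis unfolding jac_def by (rule degree_diff_le)
qed

text \<open>Suppose X = G(f, g), let W be the weighted degree of G, and let i be the multiplicity of the
  leading coefficient \<open>\<gamma>\<close> of g as a root of the specialised leading part T of G.  After i
  derivatives with respect to Y the leading terms no longer cancel, so the i-th derivative of G at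
  (f, g) has Y-degree exactly (W - i s) u.  On the other hand each derivative is an application of
  \<open>jac f\<close>, which raises the Y-degree by at most p u - 1.  Sparseness of T, where coprimality enters,
  gives i p s \<le> W, and p + s \<le> p s makes the two estimates incompatible unless i = 0.  But then the
  leading exponent of X would be W (u, v) with u > 0, so that W = 0 and X would be constant.\<close>

lemma X2_notin_subalgebra:
  assumes jac: "jac f g = const2 c" "c \<noteq> 0"
    and f: "lex_le f (p * u) (p * v)" "lex_coeff f (p * u) (p * v) \<noteq> 0"
    and g: "lex_le g (s * u) (s * v)" "lex_coeff g (s * u) (s * v) \<noteq> 0"
    and u: "u > 0" and ps: "p \<ge> 2" "s \<ge> 2" "coprime p s"
  shows "subst2 G (f, g) \<noteq> X2"
proof
  assume X: "subst2 G (f, g) = X2"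
  define \<phi> \<gamma> where "\<phi> = lex_coeff f (p * u) (p * v)" and "\<gamma> = lex_coeff g (s * u) (s * v)"
  define M where "M = {(\<beta>, \<alpha>). lex_coeff G \<beta> \<alpha> \<noteq> 0}"
  define w where "w = (\<lambda>(\<beta>, \<alpha>). p * \<alpha> + s * \<beta>)"
  have p0: "p > 0" and s0: "s > 0" using ps by auto
  have "M \<subseteq> (SIGMA \<beta>:{..degree G}. {..degree (coeff G \<beta>)})"
    by (auto simp: M_def lex_coeff_def intro!: le_degree)
  then have finM: "finite M" by (rule finite_subset) auto
  have "G \<noteq> 0" using X by (auto simp: X2_def)
  then have M0: "M \<noteq> {}" using lex_le_lead(2)[of G] by (auto simp: M_def)
  define W where "W = Max (w ` M)"
  have W: "weight_le p s W G"
    unfolding weight_le_def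
  proof (intro allI impI)
    fix \<alpha> \<beta> assume "lex_coeff G \<beta> \<alpha> \<noteq> 0"
    then have "w (\<beta>, \<alpha>) \<in> w ` M" by (auto simp: M_def)
    then have "w (\<beta>, \<alpha>) \<le> W" using finM by (simp add: W_def)
    then show "p * \<alpha> + s * \<beta> \<le> W" by (simp add: w_def)
  qed
  have "W \<in> w ` M" using finM M0 by (simp add: W_def)
  then obtain \<alpha>0 \<beta>0 where ab: "lex_coeff G \<beta>0 \<alpha>0 \<noteq> 0" "W = p * \<alpha>0 + s * \<beta>0"
    by (auto simp: M_def w_def)
  define T where "T = weighted_top p s W \<phi> G"
  have \<phi>0: "\<phi> \<noteq> 0" and \<gamma>0: "\<gamma> \<noteq> 0" using f g by (auto simp: \<phi>_def \<gamma>_def)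
  have "coeff T \<beta>0 \<noteq> 0"
    using ab p0 \<phi>0 by (simp add: T_def coeff_weighted_top[OF s0])
  then have T0: "T \<noteq> 0" by auto
  have supp: "s * \<beta> \<le> W \<and> p dvd W - s * \<beta>" if "coeff T \<beta> \<noteq> 0" for \<beta>
    using that by (auto simp: T_def coeff_weighted_top[OF s0] split: if_splits)
  define i where "i = Polynomial.order \<gamma> T"
  have "p * i \<le> degree T"
    unfolding i_def
  proof (rule order_sparse_poly[OF p0 \<gamma>0 T0])
    fix i j assume "coeff T i \<noteq> 0" "coeff T j \<noteq> 0"
    then have "W mod p = (s * i) mod p" "W mod p = (s * j) mod p"
      using supp mod_eq_dvd_iff_nat[of "s * i" W p] mod_eq_dvd_iff_nat[of "s * j" W p] by blast+
    then have "[s * i = s * j] (mod p)" by (simp add: cong_def)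
    then show "i mod p = j mod p"
      using ps(3) by (simp add: cong_mult_lcancel_nat coprime_commute cong_def[symmetric])
  qed
  then have "s * (p * i) \<le> s * degree T" by (rule mult_le_mono2)
  also have "s * degree T \<le> W" using supp[of "degree T"] T0 by simp
  finally have pis: "i * (p * s) \<le> W" by (simp add: ac_simps)
  have "i * s \<le> i * (p * s)" using p0 by simp
  then have is_W: "i * s \<le> W" using pis by linarith
  define P where "P k = subst2 ((Dy ^^ k) G) (f, g)" for k
  have Pnz: "lex_le (P i) ((W - i * s) * u) ((W - i * s) * v)" "lex_coeff (P i) ((W - i * s) * u) ((W - i * s) * v) \<noteq> 0"
  proof -
    note it = weighted_top_Dy_iter[OF W is_W s0, of \<phi>]
    note L = lead_subst2[OF f(1) g(1) u p0 s0 conjunct1[OF it]]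
    show "lex_le (P i) ((W - i * s) * u) ((W - i * s) * v)" using L(1) by (simp add: P_def)
    show "lex_coeff (P i) ((W - i * s) * u) ((W - i * s) * v) \<noteq> 0"
      using L(2) it poly_higher_pderiv_order[OF T0, of \<gamma>]
      unfolding P_def T_def \<phi>_def \<gamma>_def i_def by simp
  qed
  have degf: "degree f = p * u" using f by (rule lex_le_degree)
  have degstep: "degree (P (Suc k)) + 1 \<le> degree (P k) + p * u" for k
  proof -
    have "jac f (P k) = const2 c * P (Suc k)"
      using jac_chain[of f "(Dy ^^ k) G" g] jac by (simp add: P_def)
    moreover have "degree (const2 c * P (Suc k)) = degree (P (Suc k))"
      using jac(2) by (simp add: const2_def)
    moreover have "degree f > 0" using degf p0 u by simp
    ultimately have "degree (P (Suc k)) \<le> p * u + degree (P k) - 1" "p * u > 0"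
      using degree_jac_le[of f "P k"] degf by simp_all
    then show ?thesis by linarith
  qed
  have degs: "degree (P k) + k \<le> k * (p * u)" for k
  proof (induction k)
    case 0
    then show ?case using X by (simp add: P_def X2_def)
  next
    case (Suc k)
    then show ?case using degstep[of k] by simp
  qed
  have ps': "p + s \<le> p * s"
  proof -
    obtain a b where "p = a + 2" "s = b + 2" using ps by (metis add.commute le_add_diff_inverse)
    then show ?thesis by simp
  qed
  have "(W - i * s) * u + i \<le> i * (p * u)"
    using degs[of i] lex_le_degree[OF Pnz] by simp
  moreover have "i * p \<le> W - i * s"
  proof -
    have "i * (p + s) \<le> i * (p * s)" using ps' by (rule mult_le_mono2)
    then show ?thesis using pis by (simp add: algebra_simps)
  qed
  then have "i * (p * u) \<le> (W - i * s) * u"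
    using mult_le_mono1[of "i * p" "W - i * s" u] by (simp add: mult.assoc)
  ultimately have i0: "i = 0" by linarith
  then have "W * u = degree X2" using lex_le_degree[OF Pnz] X by (simp add: P_def)
  then have "W = 0" using u by (simp add: X2_def)
  then show False using Pnz(2) X i0 by (simp add: P_def lex_coeff_def X2_def)
qed

section \<open>Affine and triangular automorphisms\<close>

definition aff where
  "aff a b e c d k = (const2 a * X2 + const2 b * Y2 + const2 e, const2 c * X2 + const2 d * Y2 + const2 k)"

definition tri :: "complex \<Rightarrow> complex \<Rightarrow> complex \<Rightarrow> complex poly \<Rightarrow> poly2 \<times> poly2" where
  "tri a c b p = (const2 a * X2 + const2 c, const2 b * Y2 + [:p:])"

text \<open>The two families that generate the group of plane automorphisms.\<close>

definition Affine :: "(poly2 \<times> poly2) set" where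
  "Affine = {aff a b e c d k | a b e c d k. a * d - b * c \<noteq> 0}"

definition Triangular :: "(poly2 \<times> poly2) set" where
  "Triangular = {tri a c b p | a c b p. a \<noteq> 0 \<and> b \<noteq> 0}"

lemma Affine_I: "a * d - b * c \<noteq> 0 \<Longrightarrow> aff a b e c d k \<in> Affine"
  unfolding Affine_def by blast

lemma Triangular_I: "a \<noteq> 0 \<Longrightarrow> b \<noteq> 0 \<Longrightarrow> tri a c b p \<in> Triangular"
  unfolding Triangular_def by blast

lemma subst2_base: "subst2 [:p:] (u, v) = eval_hom const2 u p"
  by (simp add: subst2_def eval_hom_pCons ring_hom1_zero[OF ring_hom1_eval_hom[OF ring_hom1_const2]])

lemma subst2_base_pcompose: "subst2 [:p:] ([:q:], v) = [:pcompose p q:]"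
  unfolding subst2_base
  by (induction p) (simp_all add: eval_hom_pCons pcompose_pCons const2_def ring_hom1_zero[OF ring_hom1_const2])

lemma aff_comp:
  "aff a b e c d k \<odot> (f, g) = (const2 a * f + const2 b * g + const2 e, const2 c * f + const2 d * g + const2 k)"
  by (simp add: aff_def comp2_pair)

lemma aff_aff:
  "aff a b e c d k \<odot> aff a' b' e' c' d' k' =
   aff (a * a' + b * c') (a * b' + b * d') (a * e' + b * k' + e)
       (c * a' + d * c') (c * b' + d * d') (c * e' + d * k' + k)"
  by (simp add: aff_def comp2_pair const2_add const2_mult algebra_simps)

lemma aff_id: "aff 1 0 0 0 1 0 = (X2, Y2)"
  by (simp add: aff_def)

lemma Affine_Units: "x \<in> Affine \<Longrightarrow> x \<in> Units End_A2"
proof -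
  assume "x \<in> Affine"
  then obtain a b e c d k where x: "x = aff a b e c d k" and D: "a * d - b * c \<noteq> 0"
    by (auto simp: Affine_def)
  define D where "D = a * d - b * c"
  let ?y = "aff (d / D) (- b / D) ((b * k - d * e) / D) (- c / D) (a / D) ((c * e - a * k) / D)"
  have D0: "D \<noteq> 0" using D by (simp add: D_def)
  have "x \<odot> ?y = aff 1 0 0 0 1 0"
    unfolding x aff_aff using D0 by (simp add: field_simps) (simp add: D_def algebra_simps)
  moreover have "?y \<odot> x = aff 1 0 0 0 1 0"
    unfolding x aff_aff using D0 by (simp add: field_simps) (simp add: D_def algebra_simps)
  ultimately show ?thesis unfolding Units_End_A2_iff aff_id by blast
qed

lemma Affine_comp: "x \<in> Affine \<Longrightarrow> y \<in> Affine \<Longrightarrow> x \<odot> y \<in> Affine"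
proof -
  assume "x \<in> Affine" "y \<in> Affine"
  then obtain a b e c d k a' b' e' c' d' k' where
    x: "x = aff a b e c d k" "a * d - b * c \<noteq> 0" and y: "y = aff a' b' e' c' d' k'" "a' * d' - b' * c' \<noteq> 0"
    by (auto simp: Affine_def)
  have "(a * a' + b * c') * (c * b' + d * d') - (a * b' + b * d') * (c * a' + d * c')
    = (a * d - b * c) * (a' * d' - b' * c')" by (simp add: algebra_simps)
  then have "(a * a' + b * c') * (c * b' + d * d') - (a * b' + b * d') * (c * a' + d * c') \<noteq> 0"
    using x y by simp
  then show ?thesis unfolding x y aff_aff Affine_def by blast
qed

lemma tri_comp:
  "tri a c b p \<odot> (f, g) = (const2 a * f + const2 c, const2 b * g + subst2 [:p:] (f, g))"
  by (simp add: tri_def comp2_pair)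

lemma tri_tri: "tri a c b p \<odot> tri a' c' b' p' =
  tri (a * a') (a * c' + c) (b * b') (smult b p' + pcompose p [:c', a':])"
proof -
  have e: "const2 a' * X2 + const2 c' = [:[:c', a':]:]" by (simp add: const2_def X2_def)
  have l: "smult p' (const2 b) = [:smult b p':]" by (simp add: const2_def)
  have "subst2 [:p:] (tri a' c' b' p') = [:pcompose p [:c', a':]:]"
    by (simp add: tri_def e subst2_base_pcompose)
  then show ?thesis
    by (simp add: tri_comp[of a c b p "fst (tri a' c' b' p')" "snd (tri a' c' b' p')", simplified])
      (simp add: tri_def const2_add const2_mult algebra_simps l)
qed

lemma tri_id: "tri 1 0 1 0 = (X2, Y2)"
  by (simp add: tri_def)

lemma Triangular_comp: "x \<in> Triangular \<Longrightarrow> y \<in> Triangular \<Longrightarrow> x \<odot> y \<in> Triangular"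
  unfolding Triangular_def by (fastforce simp: tri_tri)

lemma Triangular_Units: "x \<in> Triangular \<Longrightarrow> x \<in> Units End_A2"
proof -
  assume "x \<in> Triangular"
  then obtain a c b p where x: "x = tri a c b p" "a \<noteq> 0" "b \<noteq> 0" by (auto simp: Triangular_def)
  let ?y = "tri (1 / a) (- c / a) (1 / b) (smult (- 1 / b) (pcompose p [:- c / a, 1 / a:]))"
  have "pcompose (pcompose p [:- c / a, 1 / a:]) [:c, a:] = p"
    using x(2) by (simp flip: pcompose_assoc add: pcompose_pCons)
  then have "?y \<odot> x = tri 1 0 1 0"
    unfolding x(1) tri_tri using x(2,3) by (simp add: pcompose_smult pcompose_uminus flip: smult_add_right)
  moreover have "x \<odot> ?y = tri 1 0 1 0"
    unfolding x(1) tri_tri using x(2,3) by simp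
  ultimately show ?thesis unfolding Units_End_A2_iff tri_id by blast
qed

definition swap :: "poly2 \<times> poly2" where "swap = aff 0 1 0 1 0 0"

lemma swap_comp: "swap \<odot> (f, g) = (g, f)"
  by (simp add: swap_def aff_comp)

lemma swap_Affine: "swap \<in> Affine"
  unfolding swap_def Affine_def by force

inductive_set Tame :: "(poly2 \<times> poly2) set" where
  one: "(X2, Y2) \<in> Tame"
| aff: "x \<in> Affine \<Longrightarrow> y \<in> Tame \<Longrightarrow> x \<odot> y \<in> Tame"
| tri: "x \<in> Triangular \<Longrightarrow> y \<in> Tame \<Longrightarrow> x \<odot> y \<in> Tame"

lemma Triangular_Tame: "x \<in> Triangular \<Longrightarrow> x \<in> Tame"
  using Tame.tri[OF _ Tame.one, of x] by (simp flip: one_End_A2 add: monoid.r_one[OF monoid_End_A2])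

definition shear :: "complex \<Rightarrow> nat \<Rightarrow> poly2 \<times> poly2" where "shear c s = tri 1 0 1 (monom c s)"

lemma shear_comp: "shear c s \<odot> (f, g) = (f, g + const2 c * f ^ s)"
proof -
  have "[:monom c s:] = const2 c * X2 ^ s" using monom2[of c s 0] by (simp add: monom_0)
  then show ?thesis by (simp add: shear_def tri_comp)
qed

lemma shear_Triangular: "shear c s \<in> Triangular"
  unfolding shear_def Triangular_def by force

section \<open>The theorem of Jung\<close>

lemma Units_comp: "x \<in> Units End_A2 \<Longrightarrow> y \<in> Units End_A2 \<Longrightarrow> x \<odot> y \<in> Units End_A2"
  by (rule monoid.Units_m_closed[OF monoid_End_A2])

lemma jac_nonconst:
  assumes "(f, g) \<in> Units End_A2"
  shows "jac f g \<noteq> 0"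
  using jac_Units[OF assms] by fastforce

lemma shear_reduces_leading_term:
  assumes f: "f \<noteq> 0" and g: "lex_le g (s * degree f) (s * degree (lead_coeff f))"
  obtains c where
    "g + const2 c * f ^ s = 0 \<or> degree (g + const2 c * f ^ s) < s * degree f \<or>
     degree (g + const2 c * f ^ s) = s * degree f \<and>
     degree (lead_coeff (g + const2 c * f ^ s)) < s * degree (lead_coeff f)"
proof -
  let ?n = "degree f" and ?a = "degree (lead_coeff f)"
  \<comment> \<open>the quotient of the leading coefficients of g and f^s\<close>
  define c where "c = - lex_coeff g (s * ?n) (s * ?a) / lex_coeff f ?n ?a ^ s"
  note lf = lex_le_lead[OF f]
  have m: "lex_le (const2 c * f ^ s) (s * ?n) (s * ?a)"
    "lex_coeff (const2 c * f ^ s) (s * ?n) (s * ?a) = c * lex_coeff f ?n ?a ^ s"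
    using lex_le_mult[OF lex_le_const2(1)[of c] lex_le_power(1)[OF lf(1), of s]]
    by (simp_all add: lex_le_const2 lex_le_power(2)[OF lf(1)])
  have "lex_le (g + const2 c * f ^ s) (s * ?n) (s * ?a)"
    "lex_coeff (g + const2 c * f ^ s) (s * ?n) (s * ?a) = 0"
    using lf(2) by (simp_all add: lex_le_add g m) (simp add: c_def)
  then show ?thesis using lex_le_cancel that[of c] by blast
qed

text \<open>If the leading exponent of g is s times that of f, a multiple of f^s cancels the leading term
  of g, and this is a triangular change of coordinates on the target.\<close>

lemma jung_step:
  assumes fg: "(f, g) \<in> Units End_A2" and n: "degree f > 0"
    and m: "degree g = s * degree f" "degree (lead_coeff g) = s * degree (lead_coeff f)"
  obtains c g' where "(f, g) = shear c s \<odot> (f, g')" "(f, g') \<in> Units End_A2"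
    "degree g' < degree g \<or> degree g' = degree g \<and> degree (lead_coeff g') < degree (lead_coeff g)"
proof -
  have f0: "f \<noteq> 0" using n by auto
  have "g \<noteq> 0" using jac_nonconst[OF fg] by (auto simp: jac_def Dx_def Dy_def)
  then have lg: "lex_le g (s * degree f) (s * degree (lead_coeff f))"
    using lex_le_lead(1)[of g] m by simp
  obtain c where c: "g + const2 c * f ^ s = 0 \<or> degree (g + const2 c * f ^ s) < s * degree f \<or>
     degree (g + const2 c * f ^ s) = s * degree f \<and>
     degree (lead_coeff (g + const2 c * f ^ s)) < s * degree (lead_coeff f)"
    using shear_reduces_leading_term[OF f0 lg] .
  define g' where "g' = g + const2 c * f ^ s"
  have u: "(f, g') \<in> Units End_A2"
    unfolding g'_def shear_comp[symmetric]
    by (rule Units_comp[OF Triangular_Units[OF shear_Triangular] fg])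
  have "g' \<noteq> 0" using jac_nonconst[OF u] by (auto simp: jac_def Dx_def Dy_def)
  moreover have "(f, g) = shear (- c) s \<odot> (f, g')"
    by (simp add: shear_comp g'_def const2_minus)
  ultimately show ?thesis using that u c m by (metis g'_def)
qed

lemma lead_parallel:
  assumes "(n::nat) > 0" "m > 0" "n * b = m * a"
  obtains p s u v where "p > 0" "s > 0" "u > 0" "coprime p s"
    "n = p * u" "m = s * u" "a = p * v" "b = s * v"
proof -
  define u where "u = gcd n m"
  have u: "u > 0" using assms by (simp add: u_def)
  obtain p s where ps: "n = p * u" "m = s * u" "coprime p s"
    using gcd_coprime_exists[of n m] u unfolding u_def by (metis less_numeral_extra(3))
  have p0: "p > 0" "s > 0" using ps assms by (auto intro: Nat.gr0I)
  have e: "p * b = s * a" using assms(3) ps u by (simp add: ac_simps)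
  then have "p dvd s * a" by (metis dvd_triv_left)
  then have "p dvd a" using ps(3) by (simp add: coprime_dvd_mult_right_iff)
  then obtain v where v: "a = p * v" by auto
  have "b = s * v" using e p0 v by (simp add: ac_simps)
  then show ?thesis using that p0 u ps v by blast
qed

lemma jac_const_left:
  assumes "degree f = 0" "degree (lead_coeff f) = 0"
  shows "jac f g = 0"
proof -
  obtain p where p: "f = [:p:]" using assms(1) by (auto elim: degree_eq_zeroE)
  then obtain c where "p = [:c:]" using assms(2) by (auto elim: degree_eq_zeroE)
  then have "f = const2 c" using p by (simp add: const2_def)
  then show ?thesis by (simp add: jac_def)
qed

lemma jac_swap: "jac g f = - jac f g"
  by (simp add: jac_def)

lemma degree_one_obtain:
  assumes "degree (p :: 'a :: zero poly) = 1"
  obtains c a where "p = [:c, a:]" "a \<noteq> 0"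
proof -
  obtain c q where p: "p = pCons c q" by (cases p)
  then have q: "q \<noteq> 0" "degree q = 0" using assms by (auto split: if_splits)
  then obtain a where "q = [:a:]" by (auto elim: degree_eq_zeroE)
  then show ?thesis using that p q by auto
qed

lemma Triangular_deg:
  assumes "degree f = 0" "degree (lead_coeff f) = 1" "degree g = 1" "degree (lead_coeff g) = 0"
  shows "(f, g) \<in> Triangular"
proof -
  obtain p where p: "f = [:p:]" using assms(1) by (auto elim: degree_eq_zeroE)
  obtain c a where pc: "p = [:c, a:]" "a \<noteq> 0"
    using assms(2) p degree_one_obtain[of p] by auto
  obtain q r where q: "g = [:q, r:]" "r \<noteq> 0" using assms(3) degree_one_obtain by blast
  obtain b where b: "r = [:b:]" "b \<noteq> 0" using assms(4) q by (auto elim!: degree_eq_zeroE)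
  have "(f, g) = tri a c b q"
    by (simp add: p pc q b tri_def const2_def X2_def Y2_def)
  then show ?thesis using pc b by (auto simp: Triangular_def)
qed

text \<open>Induction on the sum of the two leading exponents.  If they are not parallel, the Jacobian,
  being constant, forces them to be those of X and Y in some order.\<close>

theorem jung:
  assumes "(f, g) \<in> Units End_A2"
  shows "(f, g) \<in> Tame"
  using assms
proof (induction "(degree f + degree g, degree (lead_coeff f) + degree (lead_coeff g))" arbitrary: f g
    rule: wf_induct_rule[OF wf_lex_prod[OF wf_less_than wf_less_than]])
  case (1 f g)
  note IH = 1(1) and fg = 1(2)
  obtain c where jac: "c \<noteq> 0" "jac f g = const2 c" using jac_Units[OF fg] .
  have gf: "(g, f) \<in> Units End_A2"
    using Units_comp[OF Affine_Units[OF swap_Affine] fg] by (simp add: swap_comp)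
  have jac': "jac f g \<noteq> 0" "jac g f \<noteq> 0" using jac by (auto simp: jac_swap[of g f])
  have f0: "f \<noteq> 0" and g0: "g \<noteq> 0" using jac' by (auto simp: jac_def Dx_def Dy_def)
  define n m a b where "n = degree f" and "m = degree g"
    and "a = degree (lead_coeff f)" and "b = degree (lead_coeff g)"
  note nm = n_def m_def a_def b_def
  have lf: "lex_le f n a" "lex_coeff f n a \<noteq> 0" and lg: "lex_le g m b" "lex_coeff g m b \<noteq> 0"
    using lex_le_lead[OF f0] lex_le_lead[OF g0] by (auto simp: nm)
  show ?case
  proof (cases "n * b = m * a")
    case False
    then have "of_nat (a * m) \<noteq> (of_nat (n * b) :: complex)"
      unfolding of_nat_eq_iff by (simp add: ac_simps)
    then have "lex_coeff (X2 * Y2 * jac f g) (n + m) (a + b) \<noteq> 0"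
      using lf lg by (simp add: lead_jac)
    moreover have "X2 * Y2 * jac f g = monom (monom c 1) 1"
      using monom2[of c 1 1] by (simp add: jac ac_simps)
    ultimately have e: "n + m = 1" "a + b = 1"
      by (auto simp: lex_coeff_def coeff_monom split: if_splits)
    show ?thesis
    proof (cases "n = 0")
      case True
      then have "m = 1" "a = 1" "b = 0" using e False by auto
      then show ?thesis using Triangular_deg[of f g] True by (simp add: nm Triangular_Tame)
    next
      case False
      then have "n = 1" "m = 0" using e by auto
      then have "b = 1" "a = 0" using e \<open>n * b \<noteq> m * a\<close> by auto
      then have "(g, f) \<in> Triangular" using Triangular_deg[of g f] \<open>n = 1\<close> \<open>m = 0\<close> by (simp add: nm)
      then have "swap \<odot> (g, f) \<in> Tame" by (intro Tame.aff swap_Affine Triangular_Tame)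
      then show ?thesis by (simp add: swap_comp)
    qed
  next
    case par: True
    have "n \<noteq> 0 \<or> m \<noteq> 0"
    proof (rule ccontr)
      assume "\<not> ?thesis"
      then have "Dy f = 0" "Dy g = 0" by (auto simp: nm Dy_def pderiv_eq_0_iff)
      then show False using jac' by (simp add: jac_def)
    qed
    moreover have "\<not> (n = 0 \<and> a = 0)" "\<not> (m = 0 \<and> b = 0)"
      using jac_const_left[of f g] jac_const_left[of g f] jac' unfolding nm by blast+
    ultimately have "n > 0" "m > 0" using par by (cases "n = 0"; cases "m = 0"; auto)+
    then obtain p s u v where ps: "p > 0" "s > 0" "u > 0" "coprime p s"
      and e: "n = p * u" "m = s * u" "a = p * v" "b = s * v"
      using lead_parallel[OF _ _ par] by blast
    obtain h k where "subst2 h (f, g) = X2" using Units_obtain[OF fg] by blast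
    then have "\<not> (p \<ge> 2 \<and> s \<ge> 2)"
      using X2_notin_subalgebra[OF jac(2,1) lf[unfolded e] lg[unfolded e] ps(3) _ _ ps(4)] by blast
    then consider "p = 1" | "s = 1" using ps by linarith
    then show ?thesis
    proof cases
      case 1
      then have d: "degree g = s * degree f" "degree (lead_coeff g) = s * degree (lead_coeff f)"
        using e by (auto simp: nm)
      obtain c g' where g': "(f, g) = shear c s \<odot> (f, g')" "(f, g') \<in> Units End_A2"
        "degree g' < degree g \<or> degree g' = degree g \<and> degree (lead_coeff g') < degree (lead_coeff g)"
        using jung_step[OF fg _ d] \<open>n > 0\<close> by (auto simp: nm)
      have "(f, g') \<in> Tame" by (rule IH[OF _ g'(2)]) (use g'(3) in auto)
      then show ?thesis unfolding g'(1) by (intro Tame.tri shear_Triangular)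
    next
      case 2
      then have d: "degree f = p * degree g" "degree (lead_coeff f) = p * degree (lead_coeff g)"
        using e by (auto simp: nm)
      obtain c f' where f': "(g, f) = shear c p \<odot> (g, f')" "(g, f') \<in> Units End_A2"
        "degree f' < degree f \<or> degree f' = degree f \<and> degree (lead_coeff f') < degree (lead_coeff f)"
        using jung_step[OF gf _ d] \<open>m > 0\<close> by (auto simp: nm)
      have "(g, f') \<in> Tame" by (rule IH[OF _ f'(2)]) (use f'(3) in auto)
      then have "swap \<odot> (shear c p \<odot> (g, f')) \<in> Tame" by (intro Tame.tri Tame.aff shear_Triangular swap_Affine)
      then show ?thesis unfolding f'(1)[symmetric] by (simp add: swap_comp)
    qed
  qed
qed

section \<open>Conjugacy and words in the two subgroups\<close>

interpretation E2: monoid End_A2 by (rule monoid_End_A2)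

lemma comp2_assoc: "(x \<odot> y) \<odot> z = x \<odot> (y \<odot> z)"
  by (rule E2.m_assoc) simp_all

lemma comp2_one [simp]: "x \<odot> (X2, Y2) = x" "(X2, Y2) \<odot> x = x"
  using E2.r_one[of x] E2.l_one[of x] by (simp_all add: one_End_A2)

lemma one_Units [simp]: "(X2, Y2) \<in> Units End_A2"
  using E2.Units_one_closed by (simp add: one_End_A2)

text \<open>Conjugacy in the automorphism group, stated without inverses so that it can be used in the
  monoid of endomorphisms.\<close>

definition conj_Aut :: "poly2 \<times> poly2 \<Rightarrow> poly2 \<times> poly2 \<Rightarrow> bool" where
  "conj_Aut x y \<longleftrightarrow> x \<in> Units End_A2 \<and> y \<in> Units End_A2 \<and> (\<exists>g\<in>Units End_A2. x \<odot> g = g \<odot> y)"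

lemma Units_inverse:
  assumes "g \<in> Units End_A2"
  obtains h where "h \<in> Units End_A2" "g \<odot> h = (X2, Y2)" "h \<odot> g = (X2, Y2)"
  using assms unfolding Units_End_A2_iff by blast

lemma conj_Aut_refl: "x \<in> Units End_A2 \<Longrightarrow> conj_Aut x x"
  unfolding conj_Aut_def by (metis comp2_one one_Units)

lemma conj_Aut_sym: assumes "conj_Aut x y" shows "conj_Aut y x"
proof -
  obtain g where g: "g \<in> Units End_A2" "x \<odot> g = g \<odot> y" using assms by (auto simp: conj_Aut_def)
  obtain h where h: "h \<in> Units End_A2" "g \<odot> h = (X2, Y2)" "h \<odot> g = (X2, Y2)"
    using Units_inverse[OF g(1)] .
  have "y \<odot> h = h \<odot> (g \<odot> y) \<odot> h" using h by (simp flip: comp2_assoc)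
  also have "\<dots> = h \<odot> x" using h by (simp flip: g(2) add: comp2_assoc)
  finally show ?thesis using assms h unfolding conj_Aut_def by blast
qed

lemma conj_Aut_trans: assumes "conj_Aut x y" "conj_Aut y z" shows "conj_Aut x z"
proof -
  obtain g h where "g \<in> Units End_A2" "x \<odot> g = g \<odot> y" "h \<in> Units End_A2" "y \<odot> h = h \<odot> z"
    using assms by (auto simp: conj_Aut_def)
  moreover from this have "x \<odot> (g \<odot> h) = g \<odot> h \<odot> z" by (metis comp2_assoc)
  ultimately show ?thesis using assms unfolding conj_Aut_def by (meson Units_comp)
qed

lemma pow_Suc: "x [^]\<^bsub>End_A2\<^esub> Suc n = x [^]\<^bsub>End_A2\<^esub> n \<odot> x"
  by simp

lemma pow_0: "x [^]\<^bsub>End_A2\<^esub> (0::nat) = (X2, Y2)"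
  by (simp add: one_End_A2)

lemma conj_Aut_pow:
  assumes "x \<odot> g = g \<odot> y"
  shows "x [^]\<^bsub>End_A2\<^esub> (n::nat) \<odot> g = g \<odot> y [^]\<^bsub>End_A2\<^esub> n"
proof (induction n)
  case 0
  then show ?case by (simp add: pow_0 del: E2.nat_pow_0)
next
  case (Suc n)
  then show ?case using assms by (metis comp2_assoc pow_Suc)
qed

lemma conj_Aut_pow_one:
  assumes "conj_Aut x y" "x [^]\<^bsub>End_A2\<^esub> (n::nat) = (X2, Y2)"
  shows "y [^]\<^bsub>End_A2\<^esub> n = (X2, Y2)"
proof -
  obtain g where g: "g \<in> Units End_A2" "x \<odot> g = g \<odot> y" using assms by (auto simp: conj_Aut_def)
  obtain h where h: "h \<odot> g = (X2, Y2)" using Units_inverse[OF g(1)] .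
  have "g \<odot> y [^]\<^bsub>End_A2\<^esub> n = g" using conj_Aut_pow[OF g(2), of n] assms(2) by simp
  then show ?thesis using h by (metis comp2_assoc comp2_one(2))
qed

text \<open>A word is a list of pairs (a, b), standing for the product of all a b; a pair will consist of
  an affine and a triangular automorphism.\<close>

primrec word :: "((poly2 \<times> poly2) \<times> (poly2 \<times> poly2)) list \<Rightarrow> poly2 \<times> poly2" where
  "word [] = (X2, Y2)"
| "word (l # ws) = fst l \<odot> snd l \<odot> word ws"

lemma word_append: "word (xs @ ys) = word xs \<odot> word ys"
  by (induction xs) (simp_all add: comp2_assoc)

lemma word_replicate: "word (concat (replicate n ws)) = word ws [^]\<^bsub>End_A2\<^esub> n"
proof (induction n)
  case 0
  then show ?case by (simp add: one_End_A2)
next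
  case (Suc n)
  then show ?case
    by (simp add: word_append) (metis E2.nat_pow_Suc E2.nat_pow_Suc2 carrier_End_A2)
qed

definition factor_word :: "((poly2 \<times> poly2) \<times> (poly2 \<times> poly2)) list \<Rightarrow> bool" where
  "factor_word ws \<longleftrightarrow> set ws \<subseteq> Affine \<times> Triangular"

lemma id_Affine: "(X2, Y2) \<in> Affine"
  unfolding Affine_def aff_id[symmetric] by force

lemma id_Triangular: "(X2, Y2) \<in> Triangular"
  unfolding Triangular_def tri_id[symmetric] by force

lemma Tame_word: "x \<in> Tame \<Longrightarrow> \<exists>ws. factor_word ws \<and> x = word ws"
proof (induction rule: Tame.induct)
  case one
  then show ?case by (intro exI[of _ "[]"]) (simp add: factor_word_def)
next
  case (aff x y)
  then obtain ws where "factor_word ws" "y = word ws" by blast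
  then show ?case using aff id_Triangular
    by (intro exI[of _ "(x, (X2, Y2)) # ws"]) (simp add: factor_word_def)
next
  case (tri x y)
  then obtain ws where "factor_word ws" "y = word ws" by blast
  then show ?case using tri id_Affine
    by (intro exI[of _ "((X2, Y2), x) # ws"]) (simp add: factor_word_def)
qed

lemma word_Units: "factor_word ws \<Longrightarrow> word ws \<in> Units End_A2"
proof (induction ws)
  case (Cons l ws)
  then have "fst l \<in> Affine" "snd l \<in> Triangular" "word ws \<in> Units End_A2"
    by (auto simp: factor_word_def)
  then show ?case by (simp add: Units_comp Affine_Units Triangular_Units)
qed simp

lemma word_rotate:
  assumes "factor_word (xs @ ys)"
  shows "conj_Aut (word (xs @ ys)) (word (ys @ xs))"
proof -
  have "factor_word (ys @ xs)" "factor_word xs" using assms by (auto simp: factor_word_def)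
  moreover have "word (xs @ ys) \<odot> word xs = word xs \<odot> word (ys @ xs)"
    by (simp add: word_append comp2_assoc)
  ultimately show ?thesis using assms word_Units unfolding conj_Aut_def by blast
qed

text \<open>A letter lying in both subgroups can be merged with its two neighbours into one letter.  For
  words of length at least two the neighbours exist once the word is read cyclically, which
  conjugation permits.\<close>

lemma word_merge:
  assumes ws: "factor_word ws" "length ws \<ge> 2" "l \<in> set ws" "fst l \<in> Triangular \<or> snd l \<in> Affine"
  obtains ws' where "factor_word ws'" "length ws' < length ws" "conj_Aut (word ws) (word ws')"
proof -
  obtain xs ys where s: "ws = xs @ l # ys" using ws(3) by (meson split_list)
  define zs where "zs = ys @ xs"
  have rot: "conj_Aut (word ws) (word (l # zs))"
    using word_rotate[of xs "l # ys"] ws(1) s by (simp add: zs_def)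
  have zs: "factor_word zs" "zs \<noteq> []" "length ws = Suc (length zs)"
    and l: "fst l \<in> Affine" "snd l \<in> Triangular"
    using ws s by (auto simp: factor_word_def zs_def)
  show ?thesis
  proof (cases "snd l \<in> Affine")
    case True
    obtain l' zs' where z: "zs = l' # zs'" using zs(2) by (cases zs) auto
    let ?w = "(fst l \<odot> snd l \<odot> fst l', snd l') # zs'"
    have "word (l # zs) = word ?w" by (simp add: z comp2_assoc)
    moreover have "factor_word ?w"
      using zs(1) True l by (auto simp: factor_word_def z intro!: Affine_comp)
    ultimately show ?thesis using that[of ?w] rot zs(3) z by simp
  next
    case False
    then have t: "fst l \<in> Triangular" using ws(4) by simp
    obtain l' zs' where z: "zs = zs' @ [l']" using zs(2) by (metis rev_exhaust)
    let ?w = "(fst l', snd l' \<odot> (fst l \<odot> snd l)) # zs'"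
    have "factor_word ((l # zs') @ [l'])" using zs(1) l by (auto simp: z factor_word_def mem_Times_iff)
    then have "conj_Aut (word (l # zs)) (word (l' # l # zs'))"
      using word_rotate[of "l # zs'" "[l']"] by (simp add: z)
    moreover have "word (l' # l # zs') = word ?w" by (simp add: comp2_assoc)
    moreover have "factor_word ?w"
      using zs(1) t l by (auto simp: factor_word_def z intro!: Triangular_comp)
    ultimately show ?thesis using that[of ?w] conj_Aut_trans[OF rot] zs(3) z by simp
  qed
qed

section \<open>Ping-pong\<close>

lemma degree_eval_hom:
  "degree (eval_hom const2 h p) = degree p * degree h"
proof -
  let ?p = "map_poly (\<lambda>c. [:c:]) p"
  have "eval_hom const2 h p = pcompose ?p h"
    unfolding eval_hom_def pcompose_altdef
    by (subst map_poly_map_poly) (simp_all add: o_def const2_def[abs_def])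
  moreover have "degree ?p = degree p" by (rule degree_map_poly) simp
  ultimately show ?thesis by (simp add: degree_pcompose)
qed

lemma Triangular_not_Affine:
  assumes "x \<in> Triangular" "x \<notin> Affine"
  obtains a c b p where "x = tri a c b p" "a \<noteq> 0" "b \<noteq> 0" "degree p \<ge> 2"
proof -
  obtain a c b p where x: "x = tri a c b p" "a \<noteq> 0" "b \<noteq> 0"
    using assms by (auto simp: Triangular_def)
  have "degree p \<ge> 2"
  proof (rule ccontr)
    assume "\<not> ?thesis"
    then have "p = [:coeff p 0, coeff p 1:]"
      by (intro poly_eqI) (auto simp: coeff_pCons coeff_eq_0 split: nat.split)
    then obtain p0 p1 where p: "p = [:p0, p1:]" by blast
    have "x = aff a 0 c p1 b p0"
      unfolding x(1) p by (simp add: tri_def aff_def const2_def X2_def)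
    also have "\<dots> \<in> Affine" using x by (intro Affine_I) simp
    finally have "x \<in> Affine" .
    then show False using assms by simp
  qed
  then show ?thesis using that x by blast
qed

lemma Affine_not_Triangular:
  assumes "x \<in> Affine" "x \<notin> Triangular"
  obtains a b e c d k where "x = aff a b e c d k" "b \<noteq> 0"
proof -
  obtain a b e c d k where x: "x = aff a b e c d k" "a * d - b * c \<noteq> 0"
    using assms by (auto simp: Affine_def)
  have "b \<noteq> 0"
  proof
    assume "b = 0"
    then have "x = tri a e d [:k, c:]" "a \<noteq> 0" "d \<noteq> 0"
      using x by (auto simp: tri_def aff_def const2_def X2_def)
    then show False using assms by (auto simp: Triangular_def)
  qed
  then show ?thesis using that x by blast
qed

lemma degree_add_const2: "degree (h + const2 c) = degree h"
proof (cases "degree h = 0")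
  case True
  then obtain q where "h = [:q:]" by (auto elim: degree_eq_zeroE)
  then show ?thesis by (simp add: const2_def)
next
  case False
  then show ?thesis by (intro degree_add_eq_left) (simp add: const2_def)
qed

lemma degree_const2_mult: "degree (const2 c * h) = (if c = 0 then 0 else degree h)"
  by (simp add: const2_def)

text \<open>Think of (h1, h2) as a parametrised curve.  A triangular map of degree at least 2 makes the
  second coordinate the one of strictly larger degree, and an affine map that is not triangular
  carries that degree over to the first coordinate.\<close>

lemma ping_pong_step:
  assumes "x \<in> Affine" "x \<notin> Triangular" "y \<in> Triangular" "y \<notin> Affine"
    and h: "degree h1 \<ge> 1" "degree h2 \<le> degree h1"
  shows "degree (fst (x \<odot> (y \<odot> (h1, h2)))) > degree h1"
    and "degree (snd (x \<odot> (y \<odot> (h1, h2)))) \<le> degree (fst (x \<odot> (y \<odot> (h1, h2))))"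
proof -
  obtain a c b p where y: "y = tri a c b p" "a \<noteq> 0" "b \<noteq> 0" "degree p \<ge> 2"
    using Triangular_not_Affine assms by metis
  obtain a' b' e' c' d' k' where x: "x = aff a' b' e' c' d' k'" "b' \<noteq> 0"
    using Affine_not_Triangular assms by metis
  define k1 k2 where "k1 = const2 a * h1 + const2 c" and "k2 = const2 b * h2 + eval_hom const2 h1 p"
  have yh: "y \<odot> (h1, h2) = (k1, k2)"
    by (simp add: y(1) tri_comp subst2_base k1_def k2_def)
  have d1: "degree k1 = degree h1" using y by (simp add: k1_def degree_add_const2 degree_const2_mult)
  have "2 * degree h1 \<le> degree p * degree h1" using y(4) by (rule mult_le_mono1)
  then have lt: "degree h1 < degree p * degree h1" using h(1) by linarith
  have d2: "degree k2 = degree p * degree h1"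
    unfolding k2_def by (subst degree_add_eq_right) (use le_less_trans[OF h(2) lt] y in \<open>auto simp: degree_eval_hom degree_const2_mult\<close>)
  have f: "fst (x \<odot> (y \<odot> (h1, h2))) = const2 a' * k1 + const2 b' * k2 + const2 e'"
    and s: "snd (x \<odot> (y \<odot> (h1, h2))) = const2 c' * k1 + const2 d' * k2 + const2 k'"
    by (simp_all add: yh x(1) aff_comp)
  have "degree (const2 a' * k1 + const2 b' * k2) = degree k2"
    by (subst degree_add_eq_right) (use d1 d2 lt x in \<open>auto simp: degree_const2_mult\<close>)
  then have df: "degree (fst (x \<odot> (y \<odot> (h1, h2)))) = degree k2"
    by (simp add: f degree_add_const2)
  then show "degree (fst (x \<odot> (y \<odot> (h1, h2)))) > degree h1" using d2 lt by simp
  have "degree (const2 c' * k1 + const2 d' * k2) \<le> degree k2"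
    by (intro degree_add_le) (use d1 d2 lt in \<open>auto simp: degree_const2_mult\<close>)
  then show "degree (snd (x \<odot> (y \<odot> (h1, h2)))) \<le> degree (fst (x \<odot> (y \<odot> (h1, h2))))"
    by (simp add: df s degree_add_const2)
qed

text \<open>Each pair of factor_word restores both hypotheses on the curve.\<close>

lemma ping_pong:
  assumes "set ws \<subseteq> (Affine - Triangular) \<times> (Triangular - Affine)"
    and h: "degree h1 \<ge> 1" "degree h2 \<le> degree h1"
  shows "degree (fst (word ws \<odot> (h1, h2))) \<ge> degree h1 + length ws \<and>
    degree (snd (word ws \<odot> (h1, h2))) \<le> degree (fst (word ws \<odot> (h1, h2)))"
  using assms(1)
proof (induction ws)
  case Nil
  then show ?case using h by simp
next
  case (Cons l ws)
  obtain k1 k2 where k: "word ws \<odot> (h1, h2) = (k1, k2)" by fastforce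
  have "degree k1 \<ge> degree h1 + length ws" "degree k2 \<le> degree k1" using Cons k by auto
  moreover have "word (l # ws) \<odot> (h1, h2) = fst l \<odot> (snd l \<odot> (k1, k2))"
    by (simp add: comp2_assoc k)
  ultimately show ?case
    using ping_pong_step[of "fst l" "snd l" k1 k2] Cons.prems h by (auto simp: mem_Times_iff)
qed

text \<open>Induction on the length of a word representing a conjugate.  If no letter can be merged, the
  n-th power of the word is again such a word, and the test curve (Y, Y) shows that it is not the
  identity.\<close>

lemma finite_order_conjugate_to_factor:
  assumes f: "f \<in> Units End_A2" "f [^]\<^bsub>End_A2\<^esub> (n::nat) = (X2, Y2)" "n > 0"
  obtains y where "y \<in> Affine \<union> Triangular" "conj_Aut f y"
proof -
  have "\<exists>y \<in> Affine \<union> Triangular. conj_Aut f y" if "factor_word ws" "conj_Aut f (word ws)" for ws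
    using that
  proof (induction ws rule: length_induct)
    case (1 ws)
    consider "ws = []" | "ws \<noteq> []" "\<forall>l\<in>set ws. fst l \<notin> Triangular \<and> snd l \<notin> Affine"
      | l where "ws = [l]" "fst l \<in> Triangular \<or> snd l \<in> Affine"
      | l where "length ws \<ge> 2" "l \<in> set ws" "fst l \<in> Triangular \<or> snd l \<in> Affine"
    proof (cases "ws = [] \<or> (\<forall>l\<in>set ws. fst l \<notin> Triangular \<and> snd l \<notin> Affine)")
      case False
      then obtain l where "l \<in> set ws" "fst l \<in> Triangular \<or> snd l \<in> Affine" by blast
      moreover have "length ws \<ge> 2 \<or> ws = [l]"
        using calculation(1) by (cases ws; cases "tl ws") auto
      ultimately show ?thesis using that by blast
    qed (use that in blast)
    then show ?case
    proof cases
      case 1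
      then show ?thesis using \<open>conj_Aut f (word ws)\<close> id_Affine by auto
    next
      case 2
      define vs where "vs = concat (replicate n ws)"
      have "set vs \<subseteq> (Affine - Triangular) \<times> (Triangular - Affine)"
        using 2 \<open>factor_word ws\<close> by (fastforce simp: vs_def factor_word_def)
      moreover have d: "degree Y2 = 1" by (simp add: Y2_def)
      ultimately have "degree (fst (word vs \<odot> (Y2, Y2))) \<ge> 1 + length vs"
        using ping_pong[of vs Y2 Y2] by simp
      moreover have "word vs = (X2, Y2)"
        using conj_Aut_pow_one[OF \<open>conj_Aut f (word ws)\<close> f(2)] by (simp add: vs_def word_replicate)
      moreover have "length vs > 0" using 2 \<open>n > 0\<close> by (auto simp: vs_def)
      ultimately show ?thesis using d by simp
    next
      case 3
      then have "word ws = fst l \<odot> snd l" "fst l \<in> Affine" "snd l \<in> Triangular"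
        using \<open>factor_word ws\<close> by (auto simp: factor_word_def)
      then have "word ws \<in> Affine \<union> Triangular" using 3 Affine_comp[of "fst l" "snd l"] Triangular_comp[of "fst l" "snd l"] by auto
      then show ?thesis using \<open>conj_Aut f (word ws)\<close> by blast
    next
      case 4
      then obtain ws' where "factor_word ws'" "length ws' < length ws" "conj_Aut (word ws) (word ws')"
        using word_merge[OF \<open>factor_word ws\<close>] by metis
      then show ?thesis using 1 conj_Aut_trans by blast
    qed
  qed
  moreover obtain ws where "factor_word ws" "f = word ws"
    using Tame_word jung f(1) by (metis surj_pair)
  ultimately show ?thesis using that conj_Aut_refl[OF f(1)] by blast
qed

section \<open>Diagonalisation of plane automorphisms of finite order\<close>

lemma complex_quadratic_root: "\<exists>t::complex. t\<^sup>2 - p * t + q = 0"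
proof -
  define r where "r = csqrt (p\<^sup>2 - 4 * q)"
  have "r\<^sup>2 = p\<^sup>2 - 4 * q" by (simp add: r_def)
  moreover define t where "t = (p + r) / 2"
  have "2 * t = p + r" by (simp add: t_def)
  ultimately have "4 * (t\<^sup>2 - p * t + q) = 0" by algebra
  then show ?thesis by (metis mult_eq_0_iff zero_neq_numeral)
qed

lemma tri_linear: "tri a c b [:k, d:] = aff a 0 c d b k"
  by (simp add: tri_def aff_def const2_def X2_def)

text \<open>If (u, 1) is a left eigenvector of the linear part with eigenvalue t, then u X + Y is mapped to
  t (u X + Y) plus a constant.  Taking this linear form as the new first coordinate makes the map
  triangular.\<close>

lemma Affine_conjugate_to_Triangular:
  assumes "x \<in> Affine"
  obtains y where "y \<in> Triangular" "conj_Aut x y"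
proof (cases "x \<in> Triangular")
  case True
  then show ?thesis using that conj_Aut_refl Triangular_Units by blast
next
  case False
  obtain a b e c d k where x: "x = aff a b e c d k" and D: "a * d - b * c \<noteq> 0"
    using assms by (auto simp: Affine_def)
  have b: "b \<noteq> 0"
  proof
    assume "b = 0"
    then have "x = tri a e d [:k, c:]" "a \<noteq> 0" "d \<noteq> 0"
      using x D by (auto simp: tri_linear)
    then show False using False by (auto simp: Triangular_def)
  qed
  obtain t where t: "t\<^sup>2 - (a + d) * t + (a * d - b * c) = 0"
    using complex_quadratic_root by blast
  \<comment> \<open>t and r are the two eigenvalues of the linear part\<close>
  define u where "u = (t - d) / b"
  define r where "r = a + d - t"
  have ub: "u * b = t - d" using b by (simp add: u_def)
  have tr: "t * r = a * d - b * c" using t by (simp add: r_def power2_eq_square algebra_simps)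
  have "b * (u * a + c) = b * (t * u)"
    using tr ub unfolding r_def by algebra
  then have ua: "u * a + c = t * u" using b by simp
  define g where "g = aff u 1 0 1 0 0"
  define y where "y = tri t (u * e + k) r [:e, b:]"
  have "g \<in> Affine" unfolding g_def Affine_def by force
  then have g: "g \<in> Units End_A2" by (rule Affine_Units)
  have "t \<noteq> 0" "r \<noteq> 0" using tr D by auto
  then have y: "y \<in> Triangular" by (auto simp: y_def Triangular_def)
  have "y \<odot> g = g \<odot> x"
    unfolding y_def g_def x tri_linear aff_aff using ua ub
    by (simp add: r_def algebra_simps)
  then have "conj_Aut y x"
    using g y Affine_Units[OF assms] Triangular_Units unfolding conj_Aut_def by blast
  then show ?thesis using that y conj_Aut_sym by blast
qed

text \<open>With L = (a X, b Y), this is the mean of the L^(-i) x^i over i < n.\<close>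

definition average :: "nat \<Rightarrow> complex \<Rightarrow> complex \<Rightarrow> poly2 \<times> poly2 \<Rightarrow> poly2 \<times> poly2" where
  "average n a b x =
    (\<Sum>i<n. const2 (inverse (of_nat n * a ^ i)) * fst (x [^]\<^bsub>End_A2\<^esub> i),
     \<Sum>i<n. const2 (inverse (of_nat n * b ^ i)) * snd (x [^]\<^bsub>End_A2\<^esub> i))"

lemma average_of_powers:
  assumes "n > 0" "c \<noteq> 0"
  shows "(\<Sum>i<n. const2 (inverse (of_nat n * c ^ i)) * const2 (c ^ i) * P) = P"
proof -
  have "(\<Sum>i<n. const2 (inverse (of_nat n * c ^ i)) * const2 (c ^ i) * P) =
      (\<Sum>i<n. const2 (inverse (of_nat n)) * P)"
    using assms(2) by (intro sum.cong refl) (simp add: mult.assoc[symmetric] const2_mult[symmetric])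
  also have "\<dots> = of_nat n * (const2 (inverse (of_nat n)) * P)" by simp
  also have "of_nat n = const2 (of_nat n)" by (simp add: const2_def of_nat_poly)
  finally show ?thesis using assms(1) by (simp add: mult.assoc[symmetric] const2_mult[symmetric])
qed

lemma sum_shift_root_of_unity:
  fixes F :: "nat \<Rightarrow> poly2"
  assumes "a ^ n = 1" "F n = F 0" "n > 0"
  shows "(\<Sum>i<n. const2 (inverse (of_nat n * a ^ i)) * F (Suc i)) =
    const2 a * (\<Sum>i<n. const2 (inverse (of_nat n * a ^ i)) * F i)"
proof -
  define H where "H i = const2 (inverse (of_nat n * a ^ i)) * F i" for i
  have a: "a \<noteq> 0" using assms by (auto simp: power_0_left)
  have "(\<Sum>i<n. const2 (inverse (of_nat n * a ^ i)) * F (Suc i)) = (\<Sum>i<n. const2 a * H (Suc i))"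
    using a by (intro sum.cong refl) (simp add: H_def const2_mult[symmetric] mult.assoc[symmetric])
  also have "\<dots> = const2 a * (\<Sum>i<n. H (Suc i))" by (simp add: sum_distrib_left)
  also have "(\<Sum>i<n. H (Suc i)) = (\<Sum>i<n. H i)"
    using sum.lessThan_Suc_shift[of H n] assms by (simp add: H_def)
  finally show ?thesis by (simp add: H_def)
qed

lemma diagonal_comp: "diagonal a b \<odot> (f, g) = (const2 a * f, const2 b * g)"
  by (simp add: diagonal_def comp2_pair)

text \<open>Composing with x shifts the index of summation, which wraps around because both x and L have
  order dividing n.\<close>

lemma average_intertwines:
  assumes "x [^]\<^bsub>End_A2\<^esub> n = (X2, Y2)" "a ^ n = 1" "b ^ n = 1" "n > 0"
  shows "average n a b x \<odot> x = diagonal a b \<odot> average n a b x"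
proof -
  have 1: "subst2 (fst (x [^]\<^bsub>End_A2\<^esub> i)) x = fst (x [^]\<^bsub>End_A2\<^esub> Suc i)"
    "subst2 (snd (x [^]\<^bsub>End_A2\<^esub> i)) x = snd (x [^]\<^bsub>End_A2\<^esub> Suc i)" for i
    unfolding pow_Suc by (simp_all add: End_A2_def)
  have e: "x [^]\<^bsub>End_A2\<^esub> n = x [^]\<^bsub>End_A2\<^esub> (0::nat)" using assms(1) pow_0 by metis
  show ?thesis
    unfolding average_def comp2_pair diagonal_comp
    using sum_shift_root_of_unity[OF assms(2) _ assms(4), of "\<lambda>i. fst (x [^]\<^bsub>End_A2\<^esub> i)"]
      sum_shift_root_of_unity[OF assms(3) _ assms(4), of "\<lambda>i. snd (x [^]\<^bsub>End_A2\<^esub> i)"] e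
    by (simp add: 1 del: E2.nat_pow_Suc E2.nat_pow_0)
qed

lemma tri_pow: "\<exists>c' p'. tri a c b p [^]\<^bsub>End_A2\<^esub> i = tri (a ^ i) c' (b ^ i) p'"
proof (induction i)
  case 0
  show ?case using tri_id[symmetric] by (metis pow_0 power_0)
next
  case (Suc i)
  then show ?case unfolding pow_Suc by (metis tri_tri power_Suc2)
qed

lemma tri_eq_id:
  assumes "tri a c b p = (X2, Y2)"
  shows "a = 1" "b = 1"
  using assms by (auto simp: tri_def const2_def X2_def Y2_def one_pCons)

text \<open>For triangular x with diagonal part L, every L^(-i) x^i is triangular with diagonal part the
  identity.  So is their average, which is therefore an automorphism.\<close>

lemma Triangular_conjugate_to_diagonal:
  assumes x: "x \<in> Triangular" and n: "x [^]\<^bsub>End_A2\<^esub> (n::nat) = (X2, Y2)" "n > 0"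
  obtains a b where "a ^ n = 1" "b ^ n = 1" "conj_Aut x (diagonal a b)"
proof -
  obtain a c b p where x: "x = tri a c b p" "a \<noteq> 0" "b \<noteq> 0" using x by (auto simp: Triangular_def)
  obtain C P where CP: "x [^]\<^bsub>End_A2\<^esub> i = tri (a ^ i) (C i) (b ^ i) (P i)" for i :: nat
    using tri_pow[of a c b p] unfolding x(1) by metis
  have ab: "a ^ n = 1" "b ^ n = 1" using tri_eq_id n(1) CP by metis+
  have avg: "average n a b x = tri 1 (\<Sum>i<n. inverse (of_nat n * a ^ i) * C i) 1
      (\<Sum>i<n. smult (inverse (of_nat n * b ^ i)) (P i))"
  proof -
    have s: "const2 (\<Sum>i<n. u i) = (\<Sum>i<n. const2 (u i))" for u
      by (induction n) (simp_all add: const2_add)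
    have s': "[:(\<Sum>i<n. u i):] = (\<Sum>i<n. [:u i:])" for u :: "nat \<Rightarrow> complex poly"
      by (induction n) (simp_all, metis add_pCons add.right_neutral)
    have l: "smult q (const2 r) = [:smult r q:]" for r q by (simp add: const2_def)
    define wa wb where "wa i = inverse (of_nat n * a ^ i)" and "wb i = inverse (of_nat n * b ^ i)" for i
    show ?thesis
      unfolding average_def CP wa_def[symmetric] wb_def[symmetric]
      using average_of_powers[OF n(2) x(2), of X2, folded wa_def]
        average_of_powers[OF n(2) x(3), of Y2, folded wb_def]
      by (simp add: tri_def distrib_left sum.distrib s s' l const2_mult mult.assoc)
  qed
  have "average n a b x \<in> Triangular" unfolding avg Triangular_def by force
  then have u: "average n a b x \<in> Units End_A2" by (rule Triangular_Units)
  have "diagonal a b = tri a 0 b 0" by (simp add: diagonal_def tri_def)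
  then have "diagonal a b \<in> Triangular" using x by (auto simp: Triangular_def)
  then have "diagonal a b \<in> Units End_A2" by (rule Triangular_Units)
  moreover have "x \<in> Units End_A2" using assms(1) by (rule Triangular_Units)
  ultimately have "conj_Aut (diagonal a b) x"
    using average_intertwines[OF n(1) ab n(2)] u unfolding conj_Aut_def by metis
  then show ?thesis using that ab conj_Aut_sym by blast
qed

theorem finite_order_conjugate_to_diagonal:
  assumes f: "f \<in> Units End_A2" "f [^]\<^bsub>End_A2\<^esub> (n::nat) = (X2, Y2)" "n > 0"
  obtains a b where "a ^ n = 1" "b ^ n = 1" "conj_Aut f (diagonal a b)"
proof -
  obtain y where y: "y \<in> Affine \<union> Triangular" "conj_Aut f y"
    using finite_order_conjugate_to_factor[OF f] .
  then obtain z where z: "z \<in> Triangular" "conj_Aut f z"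
    using Affine_conjugate_to_Triangular conj_Aut_trans by (metis Un_iff)
  have "z [^]\<^bsub>End_A2\<^esub> n = (X2, Y2)" using conj_Aut_pow_one[OF z(2) f(2)] .
  then show ?thesis
    using Triangular_conjugate_to_diagonal[OF z(1) _ f(3)] conj_Aut_trans[OF z(2)] that by metis
qed

section \<open>Derivatives at fixed points\<close>

definition eval2 :: "poly2 \<Rightarrow> complex \<times> complex \<Rightarrow> complex" where
  "eval2 P p = poly (poly P [:snd p:]) (fst p)"

lemma eval2_simps [simp]:
  "eval2 (const2 c) p = c" "eval2 X2 p = fst p" "eval2 Y2 p = snd p" "eval2 0 p = 0" "eval2 1 p = 1"
  "eval2 (P + Q) p = eval2 P p + eval2 Q p" "eval2 (P * Q) p = eval2 P p * eval2 Q p" "eval2 (P - Q) p = eval2 P p - eval2 Q p"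
  by (simp_all add: eval2_def const2_def X2_def Y2_def)

lemma eval2_subst2: "eval2 (subst2 P (u, v)) p = eval2 P (eval2 u p, eval2 v p)"
  by (induction P rule: poly2_induct) simp_all

definition act :: "poly2 \<times> poly2 \<Rightarrow> complex \<times> complex \<Rightarrow> complex \<times> complex" where
  "act f p = (eval2 (fst f) p, eval2 (snd f) p)"

lemma act_comp: "act (f \<odot> g) p = act f (act g p)"
  by (cases f; cases g) (simp add: act_def comp2_pair eval2_subst2)

lemma act_id [simp]: "act (X2, Y2) p = p"
  by (simp add: act_def)

lemma act_diagonal: "act (diagonal a b) p = (a * fst p, b * snd p)"
  by (simp add: act_def diagonal_def)

text \<open>In coordinates in which g is diag(a', b'), differentiating the intertwining relation at the
  fixed point gives K diag(a', b') = diag(a, b) K for the derivative K of \<open>\<psi>\<close>.  As K is invertible,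
  the two diagonal matrices agree up to order.  The map \<open>\<psi>\<close> itself need not be an automorphism.\<close>

lemma eigenvalues_at_fixed_point:
  assumes int: "\<psi> \<odot> g = diagonal a b \<odot> \<psi>" and fp: "act g q = q"
    and jac: "eval2 (jac (fst \<psi>) (snd \<psi>)) q \<noteq> 0" and conj: "conj_Aut g (diagonal a' b')"
  shows "{a', b'} = {a, b}"
proof -
  obtain k where k: "k \<in> Units End_A2" "g \<odot> k = k \<odot> diagonal a' b'"
    using conj by (auto simp: conj_Aut_def)
  obtain h where h: "k \<odot> h = (X2, Y2)" "h \<odot> k = (X2, Y2)" using Units_inverse[OF k(1)] .
  define q' where "q' = act h q"
  have "diagonal a' b' \<odot> h = h \<odot> (k \<odot> diagonal a' b') \<odot> h"
    using h by (simp flip: comp2_assoc)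
  also have "\<dots> = h \<odot> g" using h by (simp flip: k(2) add: comp2_assoc)
  finally have "act (diagonal a' b') q' = q'"
    unfolding q'_def act_comp[symmetric] by (simp add: act_comp fp)
  then have q': "a' * fst q' = fst q'" "b' * snd q' = snd q'"
    by (auto simp: act_diagonal prod_eq_iff)
  have kq: "act k q' = q" unfolding q'_def act_comp[symmetric] using h by simp
  obtain c1 c2 where c: "\<psi> \<odot> k = (c1, c2)" by fastforce
  have "(\<psi> \<odot> k) \<odot> diagonal a' b' = (\<psi> \<odot> g) \<odot> k"
    unfolding comp2_assoc k(2) ..
  also have "\<dots> = diagonal a b \<odot> (\<psi> \<odot> k)" unfolding int comp2_assoc ..
  finally have e: "subst2 c1 (const2 a' * X2, const2 b' * Y2) = const2 a * c1"
    "subst2 c2 (const2 a' * X2, const2 b' * Y2) = const2 b * c2"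
    unfolding c diagonal_comp by (simp_all add: comp2_pair diagonal_def)
  have D: "eval2 (Dx c) q' * a' = r * eval2 (Dx c) q'" "eval2 (Dy c) q' * b' = r * eval2 (Dy c) q'"
    if "subst2 c (const2 a' * X2, const2 b' * Y2) = const2 r * c" for c r
  proof -
    have 1: "eval2 (Dx (subst2 c (const2 a' * X2, const2 b' * Y2))) q' = eval2 (Dx c) q' * a'"
      "eval2 (Dy (subst2 c (const2 a' * X2, const2 b' * Y2))) q' = eval2 (Dy c) q' * b'"
      unfolding chain_rule by (simp_all add: eval2_subst2 q')
    have 2: "eval2 (Dx (const2 r * c)) q' = r * eval2 (Dx c) q'" "eval2 (Dy (const2 r * c)) q' = r * eval2 (Dy c) q'"
      by simp_all
    show "eval2 (Dx c) q' * a' = r * eval2 (Dx c) q'" using 1(1) 2(1) that by metis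
    show "eval2 (Dy c) q' * b' = r * eval2 (Dy c) q'" using 1(2) 2(2) that by metis
  qed
  obtain k1 k2 where k12: "k = (k1, k2)" by fastforce
  obtain r where r: "r \<noteq> 0" "jac k1 k2 = const2 r" using jac_Units[of k1 k2] k(1) k12 by blast
  have "jac c1 c2 = subst2 (jac (fst \<psi>) (snd \<psi>)) k * jac k1 k2"
    using c jac_subst2[of "fst \<psi>" k1 k2 "snd \<psi>"] by (cases \<psi>) (auto simp: comp2_pair k12)
  then have "eval2 (jac c1 c2) q' = eval2 (jac (fst \<psi>) (snd \<psi>)) q * r"
    using kq by (simp add: k12 eval2_subst2 act_def r)
  then have nz: "eval2 (Dx c1) q' * eval2 (Dy c2) q' - eval2 (Dy c1) q' * eval2 (Dx c2) q' \<noteq> 0"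
    using jac r by (simp add: jac_def)
  have "eval2 (Dx c1) q' = 0 \<or> a' = a" "eval2 (Dy c1) q' = 0 \<or> b' = a"
    "eval2 (Dx c2) q' = 0 \<or> a' = b" "eval2 (Dy c2) q' = 0 \<or> b' = b"
    using D[OF e(1)] D[OF e(2)] by (metis mult.commute mult_right_cancel)+
  then show ?thesis using nz by (metis diff_self insert_commute mult_zero_left mult_zero_right)
qed

section \<open>Polynomial families over the line\<close>

text \<open>Families of plane polynomials depending polynomially on a parameter z.  Presenting them by
  generators avoids a detour through three variables when they are composed, differentiated or
  estimated.\<close>

inductive_set Family :: "(complex \<Rightarrow> poly2) set" where
  c: "(\<lambda>z. const2 c) \<in> Family"
| X: "(\<lambda>z. X2) \<in> Family"
| Y: "(\<lambda>z. Y2) \<in> Family"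
| Z: "(\<lambda>z. const2 z) \<in> Family"
| add: "F \<in> Family \<Longrightarrow> G \<in> Family \<Longrightarrow> (\<lambda>z. F z + G z) \<in> Family"
| mult: "F \<in> Family \<Longrightarrow> G \<in> Family \<Longrightarrow> (\<lambda>z. F z * G z) \<in> Family"

lemma Family_const: "(\<lambda>z. P) \<in> Family"
  by (induction P rule: poly2_induct) (auto intro: Family.intros)

lemma Family_at_Z: "(\<lambda>z. at_Z z P) \<in> Family"
proof (induction P)
  case 0
  then show ?case using Family_const[of 0] by (simp add: at_Z_def)
next
  case (pCons Q P)
  have "(\<lambda>z. Q + const2 z * at_Z z P) \<in> Family"
    by (intro Family.intros Family_const pCons)
  then show ?case by (simp add: at_Z_def)
qed

lemma Family_subst2:
  assumes "F \<in> Family" "U \<in> Family" "V \<in> Family"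
  shows "(\<lambda>z. subst2 (F z) (U z, V z)) \<in> Family"
  using assms(1) by (induction rule: Family.induct) (auto intro: Family.intros assms)

lemma Family_D: "F \<in> Family \<Longrightarrow> (\<lambda>z. Dx (F z)) \<in> Family" "F \<in> Family \<Longrightarrow> (\<lambda>z. Dy (F z)) \<in> Family"
  by (induction rule: Family.induct) (auto intro: Family.intros Family_const)

lemma Family_diff: "F \<in> Family \<Longrightarrow> G \<in> Family \<Longrightarrow> (\<lambda>z. F z - G z) \<in> Family"
  using Family.add[OF _ Family.mult[OF Family.c[of "-1"]], of F G] by (simp add: const2_minus)

lemma Family_sum: "(\<And>i. i \<in> A \<Longrightarrow> F i \<in> Family) \<Longrightarrow> (\<lambda>z. \<Sum>i\<in>A. F i z) \<in> Family"
  by (induction A rule: infinite_finite_induct) (auto intro: Family.add Family_const)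

definition Family_pair :: "(complex \<Rightarrow> poly2 \<times> poly2) \<Rightarrow> bool" where
  "Family_pair g \<longleftrightarrow> (\<lambda>z. fst (g z)) \<in> Family \<and> (\<lambda>z. snd (g z)) \<in> Family"

lemma Family_pair_const: "Family_pair (\<lambda>z. h)"
  by (simp add: Family_pair_def Family_const)

lemma Family_pair_comp: assumes "Family_pair g" "Family_pair h" shows "Family_pair (\<lambda>z. g z \<odot> h z)"
proof -
  have "g z \<odot> h z = (subst2 (fst (g z)) (fst (h z), snd (h z)), subst2 (snd (g z)) (fst (h z), snd (h z)))" for z
    by (metis comp2_pair prod.collapse)
  then show ?thesis using assms unfolding Family_pair_def
    by (simp only: fst_conv snd_conv) (intro conjI Family_subst2; simp)
qed

lemma Family_pair_pow: "Family_pair g \<Longrightarrow> Family_pair (\<lambda>z. g z [^]\<^bsub>End_A2\<^esub> (n::nat))"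
proof (induction n)
  case 0
  then show ?case by (simp add: Family_pair_const)
next
  case (Suc n)
  then show ?case unfolding pow_Suc by (intro Family_pair_comp)
qed

lemma Family_pair_average:
  assumes "Family_pair g" shows "Family_pair (\<lambda>z. average n a b (g z))"
  using Family_pair_pow[OF assms] unfolding Family_pair_def average_def fst_conv snd_conv
  by (intro conjI Family_sum Family.mult Family.c) auto

text \<open>Besides boundedness and Lipschitz bounds in p and around z0, the last clause bounds the mixed
  second difference.  It says that the Lipschitz constant of the deviation from the member at z0
  tends to 0 with z - z0, and all four bounds together are stable under products.\<close>

definition lipschitz_family :: "complex \<Rightarrow> real \<Rightarrow> (complex \<Rightarrow> complex \<times> complex \<Rightarrow> complex) \<Rightarrow> bool" where
  "lipschitz_family z0 M E \<longleftrightarrow> (\<forall>z\<in>cball z0 1. \<forall>p\<in>cball 0 2. \<forall>q\<in>cball 0 2.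
     norm (E z p) \<le> M \<and> norm (E z p - E z q) \<le> M * norm (p - q) \<and>
     norm (E z p - E z0 p) \<le> M * norm (z - z0) \<and>
     norm ((E z p - E z0 p) - (E z q - E z0 q)) \<le> M * (norm (z - z0) * norm (p - q)))"

lemma lipschitz_family_nonneg:
  assumes "lipschitz_family z0 M E"
  shows "M \<ge> 0"
proof -
  have "norm (E z0 0) \<le> M"
    using assms[unfolded lipschitz_family_def, rule_format, of z0 0 0] by simp
  then show ?thesis by (rule order.trans[OF norm_ge_zero])
qed

lemma lipschitz_family_mono:
  assumes "lipschitz_family z0 M E" "M \<le> N"
  shows "lipschitz_family z0 N E"
  unfolding lipschitz_family_def
proof (intro ballI conjI)
  fix z p q assume *: "z \<in> cball z0 1" "p \<in> cball (0::complex\<times>complex) 2" "q \<in> cball (0::complex\<times>complex) 2"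
  have mono: "x \<le> M * r \<Longrightarrow> r \<ge> 0 \<Longrightarrow> x \<le> N * r" for x r
    using mult_right_mono[OF assms(2), of r] by linarith
  note E = assms(1)[unfolded lipschitz_family_def, rule_format, OF *]
  show "norm (E z p) \<le> N" using E assms(2) by linarith
  show "norm (E z p - E z q) \<le> N * norm (p - q)"
    "norm (E z p - E z0 p) \<le> N * norm (z - z0)"
    "norm ((E z p - E z0 p) - (E z q - E z0 q)) \<le> N * (norm (z - z0) * norm (p - q))"
    using E by (auto intro!: mono)
qed

lemma lipschitz_family_add:
  assumes "lipschitz_family z0 M E" "lipschitz_family z0 M G"
  shows "lipschitz_family z0 (2 * M) (\<lambda>z p. E z p + G z p)"
  unfolding lipschitz_family_def
proof (intro ballI conjI)
  fix z p q assume *: "z \<in> cball z0 1" "p \<in> cball (0::complex\<times>complex) 2" "q \<in> cball (0::complex\<times>complex) 2"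
  note E = assms(1)[unfolded lipschitz_family_def, rule_format, OF *]
  note G = assms(2)[unfolded lipschitz_family_def, rule_format, OF *]
  show "norm (E z p + G z p) \<le> 2 * M"
    using E G by (intro norm_triangle_le) auto
  have "norm ((E z p - E z q) + (G z p - G z q)) \<le> 2 * M * norm (p - q)"
    using E G by (intro norm_triangle_le) auto
  then show "norm (E z p + G z p - (E z q + G z q)) \<le> 2 * M * norm (p - q)"
    by (simp add: algebra_simps)
  have "norm ((E z p - E z0 p) + (G z p - G z0 p)) \<le> 2 * M * norm (z - z0)"
    using E G by (intro norm_triangle_le) auto
  then show "norm (E z p + G z p - (E z0 p + G z0 p)) \<le> 2 * M * norm (z - z0)"
    by (simp add: algebra_simps)
  have "norm (((E z p - E z0 p) - (E z q - E z0 q)) + ((G z p - G z0 p) - (G z q - G z0 q)))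
      \<le> 2 * M * (norm (z - z0) * norm (p - q))"
    using E G by (intro norm_triangle_le) auto
  then show "norm (E z p + G z p - (E z0 p + G z0 p) - (E z q + G z q - (E z0 q + G z0 q)))
      \<le> 2 * M * (norm (z - z0) * norm (p - q))"
    by (simp add: algebra_simps)
qed

lemma norm_mult_bound:
  fixes x y :: complex
  assumes "norm x \<le> a" "norm y \<le> b"
  shows "norm (x * y) \<le> a * b"
  unfolding norm_mult by (rule mult_mono) (use assms in \<open>auto intro: order.trans[OF norm_ge_zero]\<close>)

lemma lipschitz_family_mult:
  assumes "lipschitz_family z0 M E" "lipschitz_family z0 M G"
  shows "lipschitz_family z0 (4 * M\<^sup>2) (\<lambda>z p. E z p * G z p)"
  unfolding lipschitz_family_def
proof (intro ballI conjI)
  fix z p q assume *: "z \<in> cball z0 1" "p \<in> cball (0::complex\<times>complex) 2" "q \<in> cball (0::complex\<times>complex) 2"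
  have z0: "z0 \<in> cball z0 1" by simp
  note E = assms(1)[unfolded lipschitz_family_def, rule_format, OF *]
    and E' = assms(1)[unfolded lipschitz_family_def, rule_format, OF *(1,3,2)]
    and E0 = assms(1)[unfolded lipschitz_family_def, rule_format, OF z0 *(2,3)]
    and E0' = assms(1)[unfolded lipschitz_family_def, rule_format, OF z0 *(3,2)]
  note G = assms(2)[unfolded lipschitz_family_def, rule_format, OF *]
    and G' = assms(2)[unfolded lipschitz_family_def, rule_format, OF *(1,3,2)]
  have M: "M \<ge> 0" "M * M \<ge> 0" using lipschitz_family_nonneg[OF assms(1)] by auto
  define d where "d = norm (p - q)"
  define e where "e = norm (z - z0)"
  have d: "d \<ge> 0" "e \<ge> 0" by (simp_all add: d_def e_def)
  have pos: "M * M * d \<ge> 0" "M * M * e \<ge> 0" using M d by simp_all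
  show "norm (E z p * G z p) \<le> 4 * M\<^sup>2"
    using norm_mult_bound[of "E z p" M "G z p" M] E G M(2) unfolding power2_eq_square by linarith
  have "norm (E z p * (G z p - G z q)) \<le> M * (M * d)" "norm ((E z p - E z q) * G z q) \<le> (M * d) * M"
    using E G G' by (auto intro!: norm_mult_bound simp: d_def)
  from norm_triangle_mono[OF this]
  have "norm (E z p * G z p - E z q * G z q) \<le> 2 * (M * M * d)"
    by (simp add: algebra_simps)
  then show "norm (E z p * G z p - E z q * G z q) \<le> 4 * M\<^sup>2 * norm (p - q)"
    using pos by (simp add: power2_eq_square d_def[symmetric])
  have "norm (E z0 p * (G z p - G z0 p)) \<le> M * (M * e)" "norm ((E z p - E z0 p) * G z p) \<le> (M * e) * M"
    using E E0 G by (auto intro!: norm_mult_bound simp: e_def)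
  from norm_triangle_mono[OF this]
  have "norm (E z p * G z p - E z0 p * G z0 p) \<le> 2 * (M * M * e)"
    by (simp add: algebra_simps)
  then show "norm (E z p * G z p - E z0 p * G z0 p) \<le> 4 * M\<^sup>2 * norm (z - z0)"
    using pos by (simp add: power2_eq_square e_def[symmetric])
  have 1: "norm (((E z p - E z0 p) - (E z q - E z0 q)) * G z p) \<le> (M * (e * d)) * M"
    using E G by (auto intro!: norm_mult_bound simp: d_def e_def)
  have 2: "norm ((E z q - E z0 q) * (G z p - G z q)) \<le> (M * e) * (M * d)"
    using E' G by (auto intro!: norm_mult_bound simp: d_def e_def)
  have 3: "norm ((E z0 p - E z0 q) * (G z p - G z0 p)) \<le> (M * d) * (M * e)"
    using E0 G by (auto intro!: norm_mult_bound simp: d_def e_def)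
  have 4: "norm (E z0 q * ((G z p - G z0 p) - (G z q - G z0 q))) \<le> M * (M * (e * d))"
    using E0' G by (auto intro!: norm_mult_bound simp: d_def e_def)
  have "norm (((E z p - E z0 p) - (E z q - E z0 q)) * G z p + (E z q - E z0 q) * (G z p - G z q)
      + (E z0 p - E z0 q) * (G z p - G z0 p) + E z0 q * ((G z p - G z0 p) - (G z q - G z0 q)))
      \<le> (M * (e * d)) * M + (M * e) * (M * d) + (M * d) * (M * e) + M * (M * (e * d))"
    by (intro norm_triangle_mono 1 2 3 4)
  then show "norm (E z p * G z p - E z0 p * G z0 p - (E z q * G z q - E z0 q * G z0 q))
      \<le> 4 * M\<^sup>2 * (norm (z - z0) * norm (p - q))"
    unfolding d_def[symmetric] e_def[symmetric] by (simp add: power2_eq_square algebra_simps)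
qed

lemma norm_fst_le': "norm (fst p) \<le> norm (p :: complex \<times> complex)"
  and norm_snd_le': "norm (snd p) \<le> norm (p :: complex \<times> complex)"
  using norm_fst_le[of "fst p" "snd p"] norm_snd_le[of "snd p" "fst p"] by simp_all

lemma Family_lipschitz: "F \<in> Family \<Longrightarrow> \<exists>M. lipschitz_family z0 M (\<lambda>z p. eval2 (F z) p)"
proof (induction rule: Family.induct)
  case (c c)
  show ?case by (intro exI[of _ "norm c"]) (auto simp: lipschitz_family_def)
next
  case X
  have "norm (fst p - fst q) \<le> 2 * norm (p - q)" for p q :: "complex \<times> complex"
    using norm_fst_le'[of "p - q"] norm_ge_zero[of "p - q"] by (simp del: norm_ge_zero)
  moreover have "norm p \<le> 2 \<Longrightarrow> norm (fst p) \<le> 2" for p :: "complex \<times> complex"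
    using norm_fst_le'[of p] by simp
  ultimately show ?case by (intro exI[of _ 2]) (auto simp: lipschitz_family_def)
next
  case Y
  have "norm (snd p - snd q) \<le> 2 * norm (p - q)" for p q :: "complex \<times> complex"
    using norm_snd_le'[of "p - q"] norm_ge_zero[of "p - q"] by (simp del: norm_ge_zero)
  moreover have "norm p \<le> 2 \<Longrightarrow> norm (snd p) \<le> 2" for p :: "complex \<times> complex"
    using norm_snd_le'[of p] by simp
  ultimately show ?case by (intro exI[of _ 2]) (auto simp: lipschitz_family_def)
next
  case Z
  have "norm z \<le> norm z0 + 1" if "dist z0 z \<le> 1" for z
    using that norm_triangle_ineq2[of z z0] by (simp add: dist_norm norm_minus_commute)
  moreover have "norm (z - z0) \<le> (norm z0 + 1) * norm (z - z0)" for z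
    by (simp add: algebra_simps)
  ultimately show ?case by (intro exI[of _ "norm z0 + 1"]) (auto simp: lipschitz_family_def)
next
  case (add F G)
  then obtain M N where "lipschitz_family z0 M (\<lambda>z p. eval2 (F z) p)" "lipschitz_family z0 N (\<lambda>z p. eval2 (G z) p)" by blast
  then have "lipschitz_family z0 (max M N) (\<lambda>z p. eval2 (F z) p)" "lipschitz_family z0 (max M N) (\<lambda>z p. eval2 (G z) p)"
    by (auto intro: lipschitz_family_mono)
  from lipschitz_family_add[OF this] show ?case by auto
next
  case (mult F G)
  then obtain M N where "lipschitz_family z0 M (\<lambda>z p. eval2 (F z) p)" "lipschitz_family z0 N (\<lambda>z p. eval2 (G z) p)" by blast
  then have "lipschitz_family z0 (max M N) (\<lambda>z p. eval2 (F z) p)" "lipschitz_family z0 (max M N) (\<lambda>z p. eval2 (G z) p)"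
    by (auto intro: lipschitz_family_mono)
  from lipschitz_family_mult[OF this] show ?case by auto
qed

lemma Family_near:
  assumes "F \<in> Family" "e > 0"
  shows "eventually (\<lambda>z. \<forall>p\<in>cball 0 2. \<forall>q\<in>cball 0 2. norm (eval2 (F z) p - eval2 (F z0) p) \<le> e \<and>
    norm ((eval2 (F z) p - eval2 (F z0) p) - (eval2 (F z) q - eval2 (F z0) q)) \<le> e * norm (p - q)) (nhds z0)"
proof -
  obtain M where M: "lipschitz_family z0 M (\<lambda>z p. eval2 (F z) p)" using Family_lipschitz[OF assms(1)] by blast
  have M0: "M \<ge> 0" using lipschitz_family_nonneg[OF M] .
  define \<delta> where "\<delta> = min 1 (e / (M + 1))"
  have \<delta>: "\<delta> > 0" "\<delta> \<le> 1" "M * \<delta> \<le> e"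
  proof -
    show "\<delta> > 0" "\<delta> \<le> 1" using assms(2) M0 by (auto simp: \<delta>_def)
    have "M * \<delta> \<le> M * (e / (M + 1))" using M0 by (intro mult_left_mono) (auto simp: \<delta>_def)
    also have "\<dots> \<le> e" using M0 assms(2) by (simp add: field_simps)
    finally show "M * \<delta> \<le> e" .
  qed
  show ?thesis
    unfolding eventually_nhds_metric
  proof (intro exI[of _ \<delta>] conjI allI impI ballI)
    fix z p q assume z: "dist z z0 < \<delta>" and pq: "p \<in> cball (0::complex\<times>complex) 2" "q \<in> cball (0::complex\<times>complex) 2"
    have zc: "z \<in> cball z0 1" using z \<delta> by (simp add: dist_commute)
    note T = M[unfolded lipschitz_family_def, rule_format, OF zc pq]
    have le: "M * norm (z - z0) \<le> e"
      using z \<delta>(3) mult_left_mono[of "norm (z - z0)" \<delta> M] M0 by (simp add: dist_norm)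
    then show "norm (eval2 (F z) p - eval2 (F z0) p) \<le> e" using T by linarith
    have "M * norm (z - z0) * norm (p - q) \<le> e * norm (p - q)" using le by (rule mult_right_mono) simp
    then show "norm ((eval2 (F z) p - eval2 (F z0) p) - (eval2 (F z) q - eval2 (F z0) q)) \<le> e * norm (p - q)"
      using T by (simp add: mult.assoc)
  qed (rule \<delta>)
qed

section \<open>Local constancy of the eigenvalues\<close>

lemma diagonal_pow: "diagonal a b [^]\<^bsub>End_A2\<^esub> (i::nat) = diagonal (a ^ i) (b ^ i)"
proof (induction i)
  case 0
  then show ?case by (simp add: one_End_A2 diagonal_def)
next
  case (Suc i)
  have "diagonal (a ^ i) (b ^ i) \<odot> diagonal a b = diagonal (a ^ Suc i) (b ^ Suc i)"
    by (subst (2) diagonal_def) (simp add: diagonal_comp, simp add: diagonal_def const2_mult ac_simps)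
  then show ?case using Suc by simp
qed

lemma average_diagonal:
  assumes "a ^ n = 1" "b ^ n = 1" "n > 0"
  shows "average n a b (diagonal a b) = (X2, Y2)"
proof -
  have "a \<noteq> 0" "b \<noteq> 0" using assms by (auto simp: power_0_left)
  then show ?thesis
    unfolding average_def diagonal_pow
    using average_of_powers[OF assms(3), of a X2] average_of_powers[OF assms(3), of b Y2]
    by (simp add: diagonal_def mult.assoc)
qed

text \<open>The average \<open>\<phi> z\<close> intertwines g z with the fixed diagonal map, and \<open>\<phi> z0\<close> is the identity.  For
  z near z0 the map p \<mapsto> p - \<open>\<phi> z\<close>(p) is a contraction of a ball, whose unique fixed point q is the
  only zero of \<open>\<phi> z\<close> there.  The intertwining relation makes the image of q under g z a zero as well,
  and that image is still in the ball; so q is fixed by g z.\<close>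

lemma eigenvalues_locally_constant:
  assumes g: "Family_pair g" and n: "\<And>z. g z [^]\<^bsub>End_A2\<^esub> n = (X2, Y2)" "n > 0"
    and z0: "g z0 = diagonal a b" and ab: "a ^ n = 1" "b ^ n = 1"
  shows "eventually (\<lambda>z. \<forall>a' b'. conj_Aut (g z) (diagonal a' b') \<longrightarrow> {a', b'} = {a, b}) (nhds z0)"
proof -
  define \<phi> where "\<phi> z = average n a b (g z)" for z
  have \<phi>: "Family_pair \<phi>" unfolding \<phi>_def using Family_pair_average[OF g] .
  have \<phi>0: "\<phi> z0 = (X2, Y2)" using average_diagonal[OF ab n(2)] by (simp add: \<phi>_def z0)
  have J: "(\<lambda>z. jac (fst (\<phi> z)) (snd (\<phi> z))) \<in> Family"
    using \<phi> unfolding jac_def Family_pair_def by (intro Family_diff Family.mult Family_D) auto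
  have F: "(\<lambda>z. fst (\<phi> z)) \<in> Family" "(\<lambda>z. snd (\<phi> z)) \<in> Family" "(\<lambda>z. fst (g z)) \<in> Family" "(\<lambda>z. snd (g z)) \<in> Family"
    using \<phi> g by (auto simp: Family_pair_def)
  have nab: "norm a = 1" "norm b = 1" using ab n(2) power_eq_1_iff by blast+
  have e: "(1/8::real) > 0" by simp
  show ?thesis
    using Family_near[OF F(1) e, of z0] Family_near[OF F(2) e, of z0] Family_near[OF F(3) e, of z0]
      Family_near[OF F(4) e, of z0] Family_near[OF J e, of z0]
  proof eventually_elim
    case (elim z)
    define S where "S = cball (0::complex\<times>complex) 2"
    define R where "R p = p - act (\<phi> z) p" for p
    have R: "R p = (fst p - eval2 (fst (\<phi> z)) p, snd p - eval2 (snd (\<phi> z)) p)" for p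
      by (simp add: R_def act_def prod_eq_iff)
    have R_small: "norm (R p) \<le> 1/4" if "p \<in> S" for p
    proof -
      have "norm (fst p - eval2 (fst (\<phi> z)) p) \<le> 1/8" "norm (snd p - eval2 (snd (\<phi> z)) p) \<le> 1/8"
        using elim(1,2) that by (auto simp: S_def \<phi>0 norm_minus_commute)
      then show ?thesis unfolding R
        using norm_Pair_le[of "fst p - eval2 (fst (\<phi> z)) p" "snd p - eval2 (snd (\<phi> z)) p"] by linarith
    qed
    have R_lip: "dist (R p) (R q) \<le> 1/4 * dist p q" if "p \<in> S" "q \<in> S" for p q
    proof -
      have "norm ((eval2 (fst (\<phi> z)) p - fst p) - (eval2 (fst (\<phi> z)) q - fst q)) \<le> 1/8 * norm (p - q)"
        "norm ((eval2 (snd (\<phi> z)) p - snd p) - (eval2 (snd (\<phi> z)) q - snd q)) \<le> 1/8 * norm (p - q)"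
        using elim(1,2) that by (auto simp: S_def \<phi>0)
      moreover have flip: "norm ((u - x) - (v - y)) = norm ((x - u) - (y - v))" for x y u v :: complex
      proof -
        have "(u - x) - (v - y) = - ((x - u) - (y - v))" by simp
        then show ?thesis by (simp only: norm_minus_cancel)
      qed
      ultimately have "norm (R p - R q) \<le> 1/8 * norm (p - q) + 1/8 * norm (p - q)"
        unfolding R diff_Pair by (intro order.trans[OF norm_Pair_le] add_mono) (simp_all only: flip)
      then show ?thesis by (simp add: dist_norm)
    qed
    have "\<exists>!p. p \<in> S \<and> R p = p"
    proof -
      have "R ` S \<subseteq> S" using R_small by (fastforce simp: S_def)
      then show ?thesis
        using Banach_fix[of S "1/4" R] R_lip by (auto simp: S_def complete_eq_closed)
    qed
    then obtain q where q: "q \<in> S" "R q = q" and uniq: "\<And>p. p \<in> S \<Longrightarrow> R p = p \<Longrightarrow> p = q" by blast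
    have \<phi>q: "act (\<phi> z) q = 0" using q by (simp add: R_def)
    have int: "\<phi> z \<odot> g z = diagonal a b \<odot> \<phi> z"
      unfolding \<phi>_def using average_intertwines[OF n(1) ab n(2)] .
    define p where "p = act (g z) q"
    have "act (\<phi> z) p = act (diagonal a b) (act (\<phi> z) q)"
      unfolding p_def act_comp[symmetric] int ..
    also have "\<dots> = 0" unfolding \<phi>q act_diagonal zero_prod_def by simp
    finally have "R p = p" by (simp add: R_def)
    moreover have "p \<in> S"
    proof -
      have "norm q \<le> 1/4" using R_small[OF q(1)] q(2) by simp
      then have "norm (a * fst q) \<le> 1/4" "norm (b * snd q) \<le> 1/4"
        using norm_fst_le'[of q] norm_snd_le'[of q] by (simp_all add: norm_mult nab)
      moreover have "norm (eval2 (fst (g z)) q - a * fst q) \<le> 1/8" "norm (eval2 (snd (g z)) q - b * snd q) \<le> 1/8"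
        using elim(3,4) q by (auto simp: S_def z0 diagonal_def)
      ultimately have "norm (eval2 (fst (g z)) q) \<le> 1" "norm (eval2 (snd (g z)) q) \<le> 1"
        using norm_triangle_sub[of "eval2 (fst (g z)) q" "a * fst q"]
          norm_triangle_sub[of "eval2 (snd (g z)) q" "b * snd q"] by linarith+
      then have "norm p \<le> 1 + 1" unfolding p_def act_def
        by (intro order.trans[OF norm_Pair_le] add_mono)
      then show ?thesis by (simp add: S_def)
    qed
    ultimately have fp: "act (g z) q = q" unfolding p_def[symmetric] by (rule uniq[rotated])
    have "norm (eval2 (jac (fst (\<phi> z)) (snd (\<phi> z))) q - 1) \<le> 1/8"
      using elim(5) q by (auto simp: S_def \<phi>0)
    then have "eval2 (jac (fst (\<phi> z)) (snd (\<phi> z))) q \<noteq> 0" by auto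
    then show ?case using eigenvalues_at_fixed_point[OF int fp] by blast
  qed
qed

section \<open>Automorphisms of affine space over a line\<close>

text \<open>Restriction to the plane Z = z is compatible with composition, as long as the inner map
  preserves that plane.\<close>

lemma at_Z_subst3: "at_Z z (subst3 P (u, v, Z3)) = subst2 (at_Z z P) (at_Z z u, at_Z z v)"
proof -
  have h: "ring_hom1 (at_Z z)" by (simp add: ring_hom1_def at_Z_def)
  have s: "at_Z z (const3 c) = const2 c" "at_Z z X3 = X2" "at_Z z Y3 = Y2" "at_Z z Z3 = const2 z" for c
    by (simp_all add: at_Z_def const3_def X3_def Y3_def Z3_def const2_def X2_def Y2_def)
  show ?thesis
    by (rule ring_hom1_poly3_eqI[OF ring_hom1_comp[OF h ring_hom1_subst3] ring_hom1_comp[OF ring_hom1_subst2 h]])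
      (simp_all add: s)
qed

lemma fibre_pow:
  assumes "fixes_last f"
  shows "fixes_last (f [^]\<^bsub>Aut_A3\<^esub> (n::nat)) \<and> fibre (f [^]\<^bsub>Aut_A3\<^esub> n) z = fibre f z [^]\<^bsub>End_A2\<^esub> n"
proof (induction n)
  case 0
  have "f [^]\<^bsub>Aut_A3\<^esub> (0::nat) = (X3, Y3, Z3)"
    by (simp add: nat_pow_def Aut_A3_def units_of_def End_A3_def)
  then show ?case
    by (simp add: fixes_last_def fibre_def at_Z_def X3_def Y3_def X2_def Y2_def one_End_A2)
next
  case (Suc n)
  define h where "h = f [^]\<^bsub>Aut_A3\<^esub> n"
  obtain u v where f: "f = (u, v, Z3)" using assms by (cases f) (auto simp: fixes_last_def)
  obtain p q where h': "h = (p, q, Z3)" using Suc by (cases h) (auto simp: fixes_last_def h_def)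
  have "f [^]\<^bsub>Aut_A3\<^esub> Suc n = h \<otimes>\<^bsub>Aut_A3\<^esub> f"
    unfolding h_def by (simp add: nat_pow_def)
  also have "\<dots> = (subst3 p f, subst3 q f, subst3 Z3 f)"
    by (simp add: h' Aut_A3_def units_of_def End_A3_def)
  finally have e: "f [^]\<^bsub>Aut_A3\<^esub> Suc n = (subst3 p f, subst3 q f, Z3)" by (simp add: f)
  have "fibre (subst3 p f, subst3 q f, Z3) z = fibre h z \<odot> fibre f z"
    by (simp add: fibre_def f h' comp2_pair at_Z_subst3)
  then show ?case using Suc unfolding e h_def by (simp add: fixes_last_def)
qed

lemma finite_order_Units:
  assumes "f [^]\<^bsub>End_A2\<^esub> (n::nat) = (X2, Y2)" "n > 0"
  shows "f \<in> Units End_A2"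
proof -
  obtain m where "n = Suc m" using assms(2) by (cases n) auto
  then have "f [^]\<^bsub>End_A2\<^esub> m \<odot> f = (X2, Y2)" "f \<odot> f [^]\<^bsub>End_A2\<^esub> m = (X2, Y2)"
    using assms(1) E2.nat_pow_Suc2[of f m] by auto
  then show ?thesis unfolding Units_End_A2_iff by blast
qed

lemma conjugate_in_Aut_A2: "conj_Aut x y \<Longrightarrow> conjugate_in Aut_A2 x y"
proof -
  assume "conj_Aut x y"
  then obtain g where g: "x \<in> Units End_A2" "y \<in> Units End_A2" "g \<in> Units End_A2" "x \<odot> g = g \<odot> y"
    by (auto simp: conj_Aut_def)
  interpret G: group Aut_A2 by (rule group_Aut_A2)
  have c: "carrier Aut_A2 = Units End_A2" by (simp add: Aut_A2_def units_of_carrier)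
  have m: "x \<otimes>\<^bsub>Aut_A2\<^esub> y = x \<odot> y" for x y by (simp add: Aut_A2_def units_of_mult)
  have "x = g \<otimes>\<^bsub>Aut_A2\<^esub> y \<otimes>\<^bsub>Aut_A2\<^esub> inv\<^bsub>Aut_A2\<^esub> g"
    using G.inv_solve_right[of x "g \<otimes>\<^bsub>Aut_A2\<^esub> y" g] g by (simp add: c m Units_comp)
  then show ?thesis using g by (auto simp: conjugate_in_def c)
qed

lemma diagonal_Units:
  assumes "a \<noteq> 0" "b \<noteq> 0" shows "diagonal a b \<in> Units End_A2"
proof -
  have "diagonal a b = tri a 0 b 0" by (simp add: diagonal_def tri_def)
  then show ?thesis using Triangular_I[OF assms] Triangular_Units by metis
qed

lemma diagonal_swap:
  assumes "a \<noteq> 0" "b \<noteq> 0" shows "conj_Aut (diagonal a b) (diagonal b a)"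
proof -
  have "diagonal a b \<odot> swap = swap \<odot> diagonal b a"
    unfolding diagonal_def[of b a] swap_comp
    by (simp add: swap_def aff_def diagonal_comp)
  then show ?thesis
    using diagonal_Units assms Affine_Units[OF swap_Affine] unfolding conj_Aut_def by blast
qed

theorem mainTheorem2:
  fixes f :: "poly3 \<times> poly3 \<times> poly3"
  assumes "f \<in> carrier Aut_A3"
    and "finite_order_in Aut_A3 f"
    and "fixes_last f"
  shows "\<exists>a b. a \<noteq> 0 \<and> b \<noteq> 0 \<and>
    (\<forall>z. conjugate_in Aut_A2 (fibre f z) (diagonal a b))"
proof -
  obtain n :: nat where n: "n > 0" "f [^]\<^bsub>Aut_A3\<^esub> n = \<one>\<^bsub>Aut_A3\<^esub>"
    using assms(2) by (auto simp: finite_order_in_def)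
  have pow: "fibre f z [^]\<^bsub>End_A2\<^esub> n = (X2, Y2)" for z
  proof -
    have "\<one>\<^bsub>Aut_A3\<^esub> = (X3, Y3, Z3)" by (simp add: Aut_A3_def units_of_def End_A3_def)
    then have "fibre (f [^]\<^bsub>Aut_A3\<^esub> n) z = (X2, Y2)"
      by (simp add: n fibre_def at_Z_def X3_def Y3_def X2_def Y2_def)
    then show ?thesis using fibre_pow[OF assms(3), of n z] by simp
  qed
  have unit: "fibre f z \<in> Units End_A2" for z using finite_order_Units[OF pow n(1)] .
  have "\<forall>z. \<exists>a b. a ^ n = 1 \<and> b ^ n = 1 \<and> conj_Aut (fibre f z) (diagonal a b)"
    using finite_order_conjugate_to_diagonal[OF unit pow n(1)] by metis
  then obtain A B where AB: "\<And>z. A z ^ n = 1" "\<And>z. B z ^ n = 1"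
    "\<And>z. conj_Aut (fibre f z) (diagonal (A z) (B z))"
    by metis
  have nz: "A z \<noteq> 0" "B z \<noteq> 0" for z using AB(1,2)[of z] n(1) by (auto simp: power_0_left)
  have fam: "Family_pair (fibre f)" by (simp add: Family_pair_def fibre_def Family_at_Z)
  have loc: "eventually (\<lambda>z. {A z, B z} = {A z0, B z0}) (nhds z0)" for z0
  proof -
    obtain k where k: "k \<in> Units End_A2" "fibre f z0 \<odot> k = k \<odot> diagonal (A z0) (B z0)"
      using AB(3)[of z0] by (auto simp: conj_Aut_def)
    obtain h where h: "h \<in> Units End_A2" "k \<odot> h = (X2, Y2)" "h \<odot> k = (X2, Y2)"
      using Units_inverse[OF k(1)] .
    \<comment> \<open>conjugating by the same k for every z keeps the family polynomial\<close>
    define g where "g z = h \<odot> (fibre f z \<odot> k)" for z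
    have gk: "fibre f z \<odot> k = k \<odot> g z" for z
      unfolding g_def comp2_assoc[symmetric] h(2) comp2_one ..
    have cg: "conj_Aut (fibre f z) (g z)" for z
    proof -
      have "g z \<in> Units End_A2" unfolding g_def by (intro Units_comp h k unit)
      then show ?thesis using gk k(1) unit unfolding conj_Aut_def by blast
    qed
    have "Family_pair g" unfolding g_def by (intro Family_pair_comp Family_pair_const fam)
    moreover have "g z [^]\<^bsub>End_A2\<^esub> n = (X2, Y2)" for z using conj_Aut_pow_one[OF cg pow] .
    moreover have "g z0 = diagonal (A z0) (B z0)"
      unfolding g_def k(2) comp2_assoc[symmetric] h(3) comp2_one ..
    ultimately have "eventually (\<lambda>z. \<forall>a' b'. conj_Aut (g z) (diagonal a' b') \<longrightarrow> {a', b'} = {A z0, B z0}) (nhds z0)"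
      using eigenvalues_locally_constant n(1) AB(1,2) by blast
    then show ?thesis
    proof eventually_elim
      case (elim z)
      then show ?case using conj_Aut_trans[OF conj_Aut_sym[OF cg] AB(3)] by blast
    qed
  qed
  have const: "{A z, B z} = {A 0, B 0}" for z
  proof -
    have "eventually (\<lambda>b. {A a, B a} = {A b, B b}) (at a within UNIV)" for a
    proof -
      have "eventually (\<lambda>b. {A b, B b} = {A a, B a}) (at a within UNIV)"
        using loc[of a] unfolding eventually_nhds_conv_at by (rule conjunct1)
      then show ?thesis by (rule eventually_mono) (rule sym)
    qed
    then show ?thesis
      using connected_local_const[OF connected_UNIV UNIV_I UNIV_I, of "\<lambda>z. {A z, B z}" z 0] by blast
  qed
  have "conj_Aut (fibre f z) (diagonal (A 0) (B 0))" for z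
  proof (cases "A z = A 0 \<and> B z = B 0")
    case True
    then show ?thesis using AB(3)[of z] by simp
  next
    case False
    then have "A z = B 0" "B z = A 0" using const[of z] by (auto simp: doubleton_eq_iff)
    then show ?thesis using conj_Aut_trans[OF AB(3)[of z]] diagonal_swap[OF nz[of z]] by simp
  qed
  then show ?thesis using nz conjugate_in_Aut_A2 by blast
qed

end
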